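(* Let $\Omega\in\mathcal{O}_C$ have thickness function $d:\partial C\to\mathbb{R}_+$ of class $C^2$ and return map $F:\partial C\to\partial C$. Assume that the return geometry is isotropic at a nondegenerate critical point $c^*$ of $d$, i.e. $A(c^* )=\alpha(c^* )I$ with $\alpha(c^* )>0$. Then: (1) the eigendirections of $\mathrm{Hess}_{\partial C}(d)(c^* )$ are uniquely determined by $DF(c^* )$; (2) the eigenvalues of $\mathrm{Hess}_{\partial C}(d)(c^* )$ are determined by $DF(c^* )$ up to the scalar factor $\alpha(c^* )$. In particular, the local shape of the thickness landscape is fully recoverable, while its absolute curvature scale depends on $\alpha(c^* )$.
   Context: Convex core. $C\subset\mathbb{R}^N$ is a compact convex set with nonempty interior whose boundary $\partial C$ is a hypersurface of class $C^2$, with the induced Riemannian structure and outward unit normal $\nu(c)$ at $c\in\partial C$. $\nabla_{\partial C}$ and $\mathrm{Hess}_{\partial C}$ are the Riemannian gradient and Hessian (the latter as a self-adjoint operator on $T_c(\partial C)$). The shape operator $S_c$ is defined by $D\nu(c)[v]=-S_cv$. Class $\mathcal{O}_C$. An open set $\Omega\subset\mathbb{R}^N$ belongs to $\mathcal{O}_C$ if: (1) $\mathrm{int}(C)\subset\Omega$; (2) $\partial\Omega$ is Lipschitz outside $C$; (3) for every $c\in\partial C$ the ray $\{c+t\nu(c):t\ge 0\}$ intersects $\Omega$ in a connected set; (4) for almost every $x\in\partial\Omega$ at which the inward unit normal $n(x)$ exists, the half-line $\{x+tn(x):t\ge0\}$ intersects $C$. Thickness function: $d(c)=\sup\{r\ge0: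 c+r\nu(c)\in\Omega\}$. Radial map: $\Phi:\partial C\to\partial\Omega$, $\Phi(c)=c+d(c)\nu(c)$. Reciprocal map: $\pi:\partial\Omega\setminus C\to\partial C$, $\pi(x)=x+t(x)n(x)$, where $n(x)$ is the inward unit normal to $\partial\Omega$ at $x$ and $t(x)$ is the smallest nonnegative number with $x+t(x)n(x)\in C$. Return map: $F=\pi\circ\Phi:\partial C\to\partial C$. Geometric operator. At a nondegenerate critical point $c^*$ of $d$ (gradient zero, Hessian invertible), the linearization of $F$ is written $DF(c^* )=I-A(c^* )\,\mathrm{Hess}_{\partial C}d(c^* )$, where $A(c^* )$ is the linear operator on $T_{c^*}(\partial C)$ given in the paper by $A(c^* )=2d(c^* )(I-d(c^* )S_{c^*})^{-1}$. *)

theory Defs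
  imports "HOL-Analysis.Analysis"
begin

section \<open>Functions and hypersurfaces of class \<open>C\<^sup>2\<close>\<close>

text \<open>\<open>G\<close> is the gradient of \<open>g\<close> and \<open>H x\<close> its Euclidean second derivative at \<open>x\<close>.\<close>

definition C2_on :: "'a::euclidean_space set \<Rightarrow> ('a \<Rightarrow> real) \<Rightarrow> bool" where
  "C2_on U g \<longleftrightarrow> (\<exists>(G :: 'a \<Rightarrow> 'a) (H :: 'a \<Rightarrow> 'a \<Rightarrow>\<^sub>L 'a).
     (\<forall>x\<in>U. (g has_derivative (\<lambda>v. G x \<bullet> v)) (at x) \<and>
            (G has_derivative blinfun_apply (H x)) (at x)) \<and>
     continuous_on U H)"

text \<open>Local graph representation: near \<open>x\<close>, the set \<open>M\<close> is the graph, over the hyperplane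
  orthogonal to the unit vector \<open>e\<close>, of a \<open>C\<^sup>2\<close> function of \<open>y - (e \<bullet> y) e\<close>.\<close>

definition C2_hypersurface :: "'a::euclidean_space set \<Rightarrow> bool" where
  "C2_hypersurface M \<longleftrightarrow> (\<forall>x\<in>M. \<exists>e r f. norm e = 1 \<and> r > 0 \<and>
     C2_on (ball (x - (e \<bullet> x) *\<^sub>R e) r) f \<and>
     (\<forall>y\<in>ball x r. y \<in> M \<longleftrightarrow> e \<bullet> y = f (y - (e \<bullet> y) *\<^sub>R e)))"

text \<open>A function on a hypersurface is \<open>C\<^sup>2\<close> if it is locally the restriction of a \<open>C\<^sup>2\<close> function on
  an open subset of the ambient space.\<close>

definition C2_on_hypersurface :: "'a::euclidean_space set \<Rightarrow> ('a \<Rightarrow> real) \<Rightarrow> bool" where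
  "C2_on_hypersurface M f \<longleftrightarrow> (\<forall>x\<in>M. \<exists>U g. open U \<and> x \<in> U \<and> C2_on U g \<and>
     (\<forall>y\<in>M \<inter> U. f y = g y))"


section \<open>Unit normals\<close>

text \<open>\<open>n\<close> is the inward unit normal of \<open>S\<close> at the boundary point \<open>x\<close>: to first order, \<open>S\<close> is the
  half-space \<open>{y. n \<bullet> (y - x) > 0}\<close> near \<open>x\<close>. Such an \<open>n\<close> is unique if it exists; for a set that is
  locally the region on one side of a graph it exists wherever the graph function is
  differentiable.\<close>

definition is_inward_normal :: "'a::euclidean_space set \<Rightarrow> 'a \<Rightarrow> 'a \<Rightarrow> bool" where
  "is_inward_normal S x n \<longleftrightarrow> x \<in> frontier S \<and> norm n = 1 \<and>
     (\<forall>\<epsilon>>0. \<forall>\<^sub>F y in at x.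
        (n \<bullet> (y - x) > \<epsilon> * norm (y - x) \<longrightarrow> y \<in> S) \<and>
        (n \<bullet> (y - x) < - \<epsilon> * norm (y - x) \<longrightarrow> y \<notin> S))"

definition inward_normal :: "'a::euclidean_space set \<Rightarrow> 'a \<Rightarrow> 'a" where
  "inward_normal S x = (THE n. is_inward_normal S x n)"

definition outward_normal :: "'a::euclidean_space set \<Rightarrow> 'a \<Rightarrow> 'a" where
  "outward_normal S x = - inward_normal S x"


section \<open>Riemannian structure of the boundary of the core\<close>

definition convex_core :: "'a::euclidean_space set \<Rightarrow> bool" where
  "convex_core C \<longleftrightarrow> compact C \<and> convex C \<and> interior C \<noteq> {} \<and> C2_hypersurface (frontier C)"

definition tangent_space :: "'a::euclidean_space set \<Rightarrow> 'a \<Rightarrow> 'a set" where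
  "tangent_space C c = {v. outward_normal C c \<bullet> v = 0}"

definition tangential_part :: "'a::euclidean_space set \<Rightarrow> 'a \<Rightarrow> 'a \<Rightarrow> 'a" where
  "tangential_part C c v = v - (outward_normal C c \<bullet> v) *\<^sub>R outward_normal C c"

text \<open>The differential at \<open>c\<close> of a map defined on the boundary of \<open>C\<close>. A derivative within the boundary
  is determined only on tangent vectors, so this operator is meaningful, and is used below, only on
  \<open>tangent_space C c\<close>.\<close>

definition boundary_differential ::
    "'a::euclidean_space set \<Rightarrow> ('a \<Rightarrow> 'a) \<Rightarrow> 'a \<Rightarrow> 'a \<Rightarrow> 'a" where
  "boundary_differential C f c = frechet_derivative f (at c within frontier C)"

definition shape_operator :: "'a::euclidean_space set \<Rightarrow> 'a \<Rightarrow> 'a \<Rightarrow> 'a" where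
  "shape_operator C c v = - boundary_differential C (outward_normal C) c v"

definition riemannian_gradient :: "'a::euclidean_space set \<Rightarrow> ('a \<Rightarrow> real) \<Rightarrow> 'a \<Rightarrow> 'a" where
  "riemannian_gradient C f c = (THE g. g \<in> tangent_space C c \<and>
     (f has_derivative (\<lambda>v. g \<bullet> v)) (at c within frontier C))"

text \<open>The Hessian operator \<open>v \<mapsto> \<nabla>\<^sub>v (grad f)\<close>; the Levi-Civita connection of the induced metric is
  the tangential part of the Euclidean derivative.\<close>

definition riemannian_hessian ::
    "'a::euclidean_space set \<Rightarrow> ('a \<Rightarrow> real) \<Rightarrow> 'a \<Rightarrow> 'a \<Rightarrow> 'a" where
  "riemannian_hessian C f c v =
     tangential_part C c (boundary_differential C (riemannian_gradient C f) c v)"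

definition nondegenerate_critical_point ::
    "'a::euclidean_space set \<Rightarrow> ('a \<Rightarrow> real) \<Rightarrow> 'a \<Rightarrow> bool" where
  "nondegenerate_critical_point C f c \<longleftrightarrow> c \<in> frontier C \<and> riemannian_gradient C f c = 0 \<and>
     bij_betw (riemannian_hessian C f c) (tangent_space C c) (tangent_space C c)"


section \<open>The class of admissible open sets\<close>

definition lipschitz_boundary_at :: "'a::euclidean_space set \<Rightarrow> 'a \<Rightarrow> bool" where
  "lipschitz_boundary_at \<Omega> x \<longleftrightarrow> (\<exists>e r L f. norm e = 1 \<and> r > 0 \<and>
     L-lipschitz_on {z. e \<bullet> z = 0} f \<and>
     (\<forall>y\<in>ball x r. y \<in> \<Omega> \<longleftrightarrow> e \<bullet> y > (f (y - (e \<bullet> y) *\<^sub>R e) :: real)))"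

text \<open>\<open>E\<close> has \<open>s\<close>-dimensional Hausdorff measure zero. The case distinction is needed only for
  \<open>s = 0\<close>, where empty covering sets must not be counted (\<open>0 ^ 0 = 1\<close>).\<close>

definition hausdorff_null :: "nat \<Rightarrow> 'a::euclidean_space set \<Rightarrow> bool" where
  "hausdorff_null s E \<longleftrightarrow> (\<forall>\<delta>>0. \<forall>\<epsilon>>0. \<exists>U :: nat \<Rightarrow> 'a set. E \<subseteq> (\<Union>i. U i) \<and>
     (\<forall>i. bounded (U i) \<and> diameter (U i) \<le> \<delta>) \<and>
     summable (\<lambda>i. if U i = {} then 0 else diameter (U i) ^ s) \<and>
     (\<Sum>i. if U i = {} then 0 else diameter (U i) ^ s) < \<epsilon>)"

definition admissible_sets :: "'a::euclidean_space set \<Rightarrow> 'a set set" where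
  "admissible_sets C = {\<Omega>. open \<Omega> \<and> interior C \<subseteq> \<Omega> \<and>
     (\<forall>x\<in>frontier \<Omega> - C. lipschitz_boundary_at \<Omega> x) \<and>
     (\<forall>c\<in>frontier C. connected ({c + t *\<^sub>R outward_normal C c |t. t \<ge> 0} \<inter> \<Omega>)) \<and>
     hausdorff_null (DIM('a) - 1)
       {x \<in> frontier \<Omega>. \<exists>n. is_inward_normal \<Omega> x n \<and> {x + t *\<^sub>R n |t. t \<ge> 0} \<inter> C = {}}}"


section \<open>Thickness function, return map and geometric operator\<close>

definition thickness_radii :: "'a::euclidean_space set \<Rightarrow> 'a set \<Rightarrow> 'a \<Rightarrow> real set" where
  "thickness_radii C \<Omega> c = {r. r \<ge> 0 \<and> c + r *\<^sub>R outward_normal C c \<in> \<Omega>}"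

text \<open>The supremum is taken in \<open>[0,\<infinity>)\<close>: inserting \<open>0\<close> only affects rays that miss \<open>\<Omega>\<close>, where the
  thickness is \<open>0\<close>. Finiteness of the supremum is the separate predicate \<open>finite_thickness\<close>.\<close>

definition thickness :: "'a::euclidean_space set \<Rightarrow> 'a set \<Rightarrow> 'a \<Rightarrow> real" where
  "thickness C \<Omega> c = Sup (insert 0 (thickness_radii C \<Omega> c))"

definition finite_thickness :: "'a::euclidean_space set \<Rightarrow> 'a set \<Rightarrow> bool" where
  "finite_thickness C \<Omega> \<longleftrightarrow> (\<forall>c\<in>frontier C. bdd_above (thickness_radii C \<Omega> c))"

definition radial_map :: "'a::euclidean_space set \<Rightarrow> 'a set \<Rightarrow> 'a \<Rightarrow> 'a" where
  "radial_map C \<Omega> c = c + thickness C \<Omega> c *\<^sub>R outward_normal C c"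

definition reciprocal_map :: "'a::euclidean_space set \<Rightarrow> 'a set \<Rightarrow> 'a \<Rightarrow> 'a" where
  "reciprocal_map C \<Omega> x =
     x + (LEAST t. t \<ge> 0 \<and> x + t *\<^sub>R inward_normal \<Omega> x \<in> C) *\<^sub>R inward_normal \<Omega> x"

definition return_map :: "'a::euclidean_space set \<Rightarrow> 'a set \<Rightarrow> 'a \<Rightarrow> 'a" where
  "return_map C \<Omega> = reciprocal_map C \<Omega> \<circ> radial_map C \<Omega>"

text \<open>\<open>A(c) = 2 d(c) (I - d(c) S\<^sub>c)\<^sup>-\<^sup>1\<close> as an operator on the tangent space. (By convexity \<open>S\<^sub>c\<close> is
  negative semidefinite, so the inverse exists.)\<close>

definition geometric_operator :: "'a::euclidean_space set \<Rightarrow> 'a set \<Rightarrow> 'a \<Rightarrow> 'a \<Rightarrow> 'a" where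
  "geometric_operator C \<Omega> c v = (2 * thickness C \<Omega> c) *\<^sub>R
     inv_into (tangent_space C c) (\<lambda>w. w - thickness C \<Omega> c *\<^sub>R shape_operator C c w) v"

abbreviation thickness_hessian :: "'a::euclidean_space set \<Rightarrow> 'a set \<Rightarrow> 'a \<Rightarrow> 'a \<Rightarrow> 'a" where
  "thickness_hessian C \<Omega> c \<equiv> riemannian_hessian C (thickness C \<Omega>) c"

text \<open>Two meanings of \<open>DF(c)\<close> at a critical point \<open>c\<close> of the thickness: the actual differential of
  the return map, and the operator \<open>I - A(c) Hess d(c)\<close>. They are kept apart, because with
  \<open>A(c)\<close> as above they do not coincide: differentiating \<open>F\<close> at a critical point with \<open>d(c) > 0\<close> gives
  \<open>I + (1/2) A(c) Hess d(c)\<close>, so that identifying the two would be contradictory at a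
  nondegenerate critical point when the tangent space is nontrivial.\<close>

definition return_differential :: "'a::euclidean_space set \<Rightarrow> 'a set \<Rightarrow> 'a \<Rightarrow> 'a \<Rightarrow> 'a" where
  "return_differential C \<Omega> c = boundary_differential C (return_map C \<Omega>) c"

definition return_linearization :: "'a::euclidean_space set \<Rightarrow> 'a set \<Rightarrow> 'a \<Rightarrow> 'a \<Rightarrow> 'a" where
  "return_linearization C \<Omega> c v =
     v - geometric_operator C \<Omega> c (thickness_hessian C \<Omega> c v)"

definition isotropic_return ::
    "'a::euclidean_space set \<Rightarrow> 'a set \<Rightarrow> 'a \<Rightarrow> real \<Rightarrow> bool" where
  "isotropic_return C \<Omega> c \<alpha> \<longleftrightarrow>
     convex_core C \<and> \<Omega> \<in> admissible_sets C \<and>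
     finite_thickness C \<Omega> \<and> C2_on_hypersurface (frontier C) (thickness C \<Omega>) \<and>
     nondegenerate_critical_point C (thickness C \<Omega>) c \<and>
     \<alpha> > 0 \<and> (\<forall>v\<in>tangent_space C c. geometric_operator C \<Omega> c v = \<alpha> *\<^sub>R v)"


section \<open>Eigendirections and eigenvalues of an operator on a subspace\<close>

definition eigendirections :: "'a::euclidean_space set \<Rightarrow> ('a \<Rightarrow> 'a) \<Rightarrow> 'a set set" where
  "eigendirections T L = {span {v} |v. v \<in> T \<and> v \<noteq> 0 \<and> (\<exists>\<mu>::real. L v = \<mu> *\<^sub>R v)}"

definition eigenvalues :: "'a::euclidean_space set \<Rightarrow> ('a \<Rightarrow> 'a) \<Rightarrow> real set" where
  "eigenvalues T L = {\<mu>. \<exists>v\<in>T. v \<noteq> 0 \<and> L v = \<mu> *\<^sub>R v}"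

end

theory Submission
  imports Defs
begin
text \<open>Write \<open>\<nu>\<close>, \<open>d\<close> for the outward normal of \<open>C\<close> and the thickness. Near \<open>\<Phi> c\<close> the set
  \<open>\<Omega>\<close> is the region \<open>dist y C < d (P y)\<close>, where \<open>P\<close> is the nearest-point projection onto \<open>C\<close>. Hence
  the inward normal of \<open>\<Omega>\<close> at \<open>\<Phi> p\<close> points along \<open>w - \<nu> p\<close>, where the tangent vector \<open>w\<close> solves
  \<open>(I + d D\<nu>)\<^sup>T w = grad d\<close>. Isotropy says \<open>I + d D\<nu> = l I\<close> at \<open>c\<close> with \<open>l = 2 d / \<alpha>\<close>, so that
  \<open>w = Hess d (p - c) / l\<close> to first order; following the normal line from \<open>\<Phi> p\<close> back to \<open>C\<close> gives
  \<open>F p = p + d w\<close> to first order. Therefore the true differential of \<open>F\<close> is \<open>I + (\<alpha> / 2) Hess d\<close>,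
  whereas the operator \<open>I - A Hess d\<close> is \<open>I - \<alpha> Hess d\<close>. Both have the form \<open>I + k \<alpha> Hess d\<close> with a
  universal \<open>k \<noteq> 0\<close>, which determines the eigendirections of \<open>Hess d\<close>, and \<open>\<alpha> Hess d\<close> itself.\<close>

section \<open>Derivatives within a hypersurface\<close>

text \<open>The equation for \<open>w\<close> expresses orthogonality: the derivative of the radial
  map sends a tangent vector \<open>\<theta>\<close> to \<open>\<theta> + d D\<nu> \<theta> + (grad
  d \<bullet> \<theta>) \<nu>\<close>, and pairing this with \<open>w - \<nu>\<close> leaves
  \<open>w \<bullet> (\<theta> + d D\<nu> \<theta>) - grad d \<bullet> \<theta>\<close>. The value
  of \<open>F\<close> comes from splitting \<open>p + d \<nu>\<close> as
  \<open>(p + d w) + d (\<nu> - w)\<close>: the normal line passes through \<open>p + d w\<close>,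
  which is within \<open>o (norm (p - c))\<close> of the hyperplane tangent at \<open>c\<close>. The
  obstacle is low regularity: the normals involve \<open>D\<nu>\<close>, which is merely continuous,
  so they cannot be differentiated term by term. At \<open>c\<close> this does no harm, because
  \<open>grad d\<close> vanishes there: \<open>w\<close> is already of order
  \<open>norm (p - c)\<close>, and continuity of \<open>D\<nu>\<close> at \<open>c\<close> is
  enough. Convexity replaces the inverse and implicit function theorems: the nearest-point
  projection and the distance to \<open>C\<close> are Lipschitz with constant 1, and
  \<open>C\<close> is compared at \<open>c\<close> with a half-space and a cone.\<close>

text \<open>The last clause makes every vector orthogonal to \<open>m\<close> tangent to \<open>M\<close> at \<open>q\<close>, with an error uniform in
  the direction. It is what makes derivatives within \<open>M\<close> unique on tangent vectors.\<close>

definition hypersurface_normal :: "'a::euclidean_space set \<Rightarrow> 'a \<Rightarrow> 'a \<Rightarrow> bool" where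
  "hypersurface_normal M q m \<longleftrightarrow> m \<noteq> 0 \<and>
     ((\<lambda>_. 0::real) has_derivative (\<lambda>v. m \<bullet> v)) (at q within M) \<and>
     (\<forall>\<epsilon>>0. \<exists>\<delta>>0. \<forall>\<tau>. m \<bullet> \<tau> = 0 \<and> norm \<tau> < \<delta> \<longrightarrow>
        (\<exists>y\<in>M. norm (y - q - \<tau>) \<le> \<epsilon> * norm \<tau>))"

lemma hypersurface_normal_scaleR:
  assumes "hypersurface_normal M q m" "k \<noteq> 0"
  shows "hypersurface_normal M q (k *\<^sub>R m)"
proof -
  have "((\<lambda>_. k * (0::real)) has_derivative (\<lambda>v. k * (m \<bullet> v))) (at q within M)"
    using assms by (intro has_derivative_mult_right) (auto simp: hypersurface_normal_def)
  with assms show ?thesis by (simp add: hypersurface_normal_def)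
qed

text \<open>The difference \<open>L\<close> of the two derivatives is a derivative of the zero
  function, so it is small on increments \<open>y - q\<close> with \<open>y\<close> in
  \<open>M\<close>. Replacing \<open>t *\<^sub>R v\<close> by such an increment, with relative error
  \<open>\<epsilon>\<close>, bounds \<open>norm (L v)\<close> by a fixed multiple of
  \<open>\<epsilon>\<close>.\<close>

lemma has_derivative_eq_on_tangents:
  fixes f :: "'a::euclidean_space \<Rightarrow> 'b::real_normed_vector"
  assumes hn: "hypersurface_normal M q m"
    and f1: "(f has_derivative f1) (at q within M)" and f2: "(f has_derivative f2) (at q within M)"
    and v: "m \<bullet> v = 0"
  shows "f1 v = f2 v"
proof -
  define L where "L = (\<lambda>v. f1 v - f2 v)"
  have "((\<lambda>y. f y - f y) has_derivative L) (at q within M)"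
    unfolding L_def by (rule has_derivative_diff[OF f1 f2])
  then have L0: "((\<lambda>_. 0) has_derivative L) (at q within M)" by simp
  then have bl: "bounded_linear L" by (rule has_derivative_bounded_linear)
  then interpret L: bounded_linear L .
  obtain K where K: "K > 0" "\<And>u. norm (L u) \<le> norm u * K" using L.pos_bounded by blast
  have "norm (L v) \<le> \<epsilon> * ((2 + K) * norm v)" if eps: "0 < \<epsilon>" "\<epsilon> < 1" for \<epsilon>
  proof (cases "v = 0")
    case False
    obtain \<delta>1 where \<delta>1: "\<delta>1 > 0"
      "\<And>y. y \<in> M \<Longrightarrow> norm (y - q) < \<delta>1 \<Longrightarrow> norm (L (y - q)) \<le> \<epsilon> * norm (y - q)"
      using L0 eps unfolding has_derivative_within_alt by fastforce
    obtain \<delta>2 where \<delta>2: "\<delta>2 > 0"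
      "\<And>\<tau>. m \<bullet> \<tau> = 0 \<Longrightarrow> norm \<tau> < \<delta>2 \<Longrightarrow> \<exists>y\<in>M. norm (y - q - \<tau>) \<le> \<epsilon> * norm \<tau>"
      using hn eps unfolding hypersurface_normal_def by metis
    \<comment> \<open>The factor 3 leaves room for \<open>norm (y - q)\<close>, which can be twice
      \<open>norm (t *\<^sub>R v)\<close> and must stay below \<open>\<delta>1\<close>.\<close>
    define t where "t = min \<delta>1 \<delta>2 / (3 * norm v)"
    have t: "t > 0" using \<delta>1 \<delta>2 False by (simp add: t_def)
    have "norm (t *\<^sub>R v) = min \<delta>1 \<delta>2 / 3" using \<delta>1(1) \<delta>2(1) False by (simp add: t_def)
    then have nt: "norm (t *\<^sub>R v) < \<delta>2" "2 * norm (t *\<^sub>R v) < \<delta>1" using \<delta>1(1) \<delta>2(1) by linarith+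
    obtain y where y: "y \<in> M" "norm (y - q - t *\<^sub>R v) \<le> \<epsilon> * norm (t *\<^sub>R v)"
      using \<delta>2(2)[of "t *\<^sub>R v"] v nt by auto
    have "norm (y - q) \<le> norm (y - q - t *\<^sub>R v) + norm (t *\<^sub>R v)"
      using norm_triangle_ineq[of "y - q - t *\<^sub>R v" "t *\<^sub>R v"] by simp
    moreover have "\<epsilon> * norm (t *\<^sub>R v) \<le> 1 * norm (t *\<^sub>R v)"
      using eps by (intro mult_right_mono) auto
    ultimately have ny: "norm (y - q) \<le> 2 * norm (t *\<^sub>R v)" using y by linarith
    have "L (t *\<^sub>R v) = L (y - q) - L (y - q - t *\<^sub>R v)" by (simp add: L.diff)
    then have "norm (L (t *\<^sub>R v)) \<le> norm (L (y - q)) + norm (L (y - q - t *\<^sub>R v))"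
      by (metis norm_triangle_ineq4)
    also have "\<dots> \<le> \<epsilon> * norm (y - q) + norm (y - q - t *\<^sub>R v) * K"
      using \<delta>1(2)[OF y(1)] ny nt K(2) by (intro add_mono) auto
    also have "\<dots> \<le> \<epsilon> * (2 * norm (t *\<^sub>R v)) + (\<epsilon> * norm (t *\<^sub>R v)) * K"
      using ny y K eps by (intro add_mono mult_left_mono mult_right_mono) auto
    finally have "t * norm (L v) \<le> t * (\<epsilon> * ((2 + K) * norm v))"
      using t by (simp add: L.scaleR algebra_simps)
    then show ?thesis using t by simp
  qed simp
  then have ev: "\<forall>\<^sub>F \<epsilon> in at_right 0. norm (L v) \<le> \<epsilon> * ((2 + K) * norm v)"
    unfolding eventually_at_right_field by (intro exI[of _ 1]) auto
  have "((\<lambda>\<epsilon>. \<epsilon> * ((2 + K) * norm v)) \<longlongrightarrow> 0 * ((2 + K) * norm v)) (at_right 0)"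
    by (intro tendsto_intros)
  from tendsto_lowerbound[OF this ev] have "norm (L v) \<le> 0"
    by (simp add: trivial_limit_at_right_real)
  then show ?thesis by (simp add: L_def)
qed

text \<open>Two linear maps that agree on the hyperplane orthogonal to \<open>m\<close> differ by
  \<open>(m \<bullet> v) *\<^sub>R k\<close> for a fixed \<open>k\<close>, and this is itself a
  derivative of zero within \<open>M\<close>. Derivatives within \<open>M\<close> may therefore be
  altered freely in the normal direction.\<close>

lemma has_derivative_tangent_cong:
  fixes f :: "'a::euclidean_space \<Rightarrow> 'b::real_normed_vector"
  assumes hn: "hypersurface_normal M q m"
    and f1: "(f has_derivative f1) (at q within M)" and f2: "bounded_linear f2"
    and eq: "\<And>v. m \<bullet> v = 0 \<Longrightarrow> f1 v = f2 v"
  shows "(f has_derivative f2) (at q within M)"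
proof -
  define k where "k = (f1 m - f2 m) /\<^sub>R (m \<bullet> m)"
  interpret f1: bounded_linear f1 using f1 by (rule has_derivative_bounded_linear)
  interpret f2: bounded_linear f2 by (rule f2)
  have m: "m \<bullet> m \<noteq> 0" using hn by (simp add: hypersurface_normal_def)
  have f12: "f2 v = f1 v - (m \<bullet> v) *\<^sub>R k" for v
  proof -
    define a where "a = (m \<bullet> v) / (m \<bullet> m)"
    have "f1 (v - a *\<^sub>R m) = f2 (v - a *\<^sub>R m)"
      by (rule eq) (use m in \<open>simp add: inner_diff_right a_def\<close>)
    then show ?thesis
      by (simp add: f1.diff f2.diff f1.scaleR f2.scaleR k_def a_def algebra_simps divide_inverse)
  qed
  have "((\<lambda>_. 0 *\<^sub>R k) has_derivative (\<lambda>v. (m \<bullet> v) *\<^sub>R k)) (at q within M)"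
    using hn by (intro has_derivative_scaleR_left) (auto simp: hypersurface_normal_def)
  from has_derivative_diff[OF f1 this] show ?thesis
    by (simp add: f12[abs_def])
qed

lemma norm_reject_le:
  fixes e v :: "'a::real_inner"
  assumes "norm e = 1"
  shows "norm (v - (e \<bullet> v) *\<^sub>R e) \<le> norm v"
proof -
  have "(norm (v - (e \<bullet> v) *\<^sub>R e))\<^sup>2 = (norm v)\<^sup>2 - (e \<bullet> v)\<^sup>2"
    using assms unfolding power2_norm_eq_inner
    by (simp add: inner_diff_left inner_diff_right inner_commute algebra_simps norm_eq_1 power2_eq_square)
  also have "\<dots> \<le> (norm v)\<^sup>2" by simp
  finally show ?thesis using power2_le_imp_le by auto
qed

lemma C2_hypersurface_chart:
  assumes M: "C2_hypersurface M" and x: "x \<in> M"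
  obtains r m and Dm :: "'a::euclidean_space \<Rightarrow> 'a \<Rightarrow>\<^sub>L 'a" where "r > 0"
    "\<And>y. y \<in> ball x r \<Longrightarrow> m y \<noteq> 0"
    "\<And>y. y \<in> ball x r \<Longrightarrow> (m has_derivative blinfun_apply (Dm y)) (at y)"
    "continuous_on (ball x r) Dm"
    "\<And>q. q \<in> M \<Longrightarrow> q \<in> ball x r \<Longrightarrow> hypersurface_normal M q (m q)"
proof -
  obtain e r f where e: "norm e = 1" and r: "r > 0" and
     C2: "C2_on (ball (x - (e \<bullet> x) *\<^sub>R e) r) f" and
     graph: "\<And>y. y \<in> ball x r \<Longrightarrow> y \<in> M \<longleftrightarrow> e \<bullet> y = f (y - (e \<bullet> y) *\<^sub>R e)"
    using M x unfolding C2_hypersurface_def by blast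
  define P where "P y = y - (e \<bullet> y) *\<^sub>R e" for y
  have Pbl: "bounded_linear P" unfolding P_def
    by (intro bounded_linear_intros)
  then interpret P: bounded_linear P .
  have ee: "e \<bullet> e = 1" using e by (simp add: norm_eq_1)
  have Psa: "P a \<bullet> b = a \<bullet> P b" for a b
    by (simp add: P_def inner_diff_left inner_diff_right inner_commute)
  have Pe: "P e = 0" by (simp add: P_def ee)
  have Ple: "norm (P v) \<le> norm v" for v unfolding P_def by (rule norm_reject_le[OF e])
  have Pball: "P y \<in> ball (P x) r" if "y \<in> ball x r" for y
    using that Ple[of "x - y"] by (auto simp: dist_norm P.diff)
  obtain G H where GH: "\<And>z. z \<in> ball (P x) r \<Longrightarrow> (f has_derivative (\<lambda>v. G z \<bullet> v)) (at z)"
    "\<And>z. z \<in> ball (P x) r \<Longrightarrow> (G has_derivative blinfun_apply (H z)) (at z)"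
    "continuous_on (ball (P x) r) H"
    using C2 unfolding C2_on_def P_def[symmetric] by blast
  \<comment> \<open>This is the gradient of \<open>e \<bullet> y - f (P y)\<close>, whose zero set
    is \<open>M\<close> near \<open>x\<close>. It makes sense on a whole ambient ball, and
    \<open>e \<bullet> m y = 1\<close> keeps it from vanishing.\<close>
  define m where "m y = e - P (G (P y))" for y
  define PL where "PL = Blinfun P"
  have PL: "blinfun_apply PL = P" unfolding PL_def by (rule bounded_linear_Blinfun_apply[OF Pbl])
  define Dm where "Dm y = - (PL o\<^sub>L H (P y) o\<^sub>L PL)" for y
  show ?thesis
  proof (rule that[OF r])
    fix y assume y: "y \<in> ball x r"
    have "e \<bullet> m y = 1" by (simp add: m_def inner_diff_right ee Psa[symmetric] Pe)
    then show "m y \<noteq> 0" by auto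
    have "((\<lambda>y. G (P y)) has_derivative (\<lambda>v. H (P y) (P v))) (at y)"
      using diff_chain_at[OF P.has_derivative[OF has_derivative_ident] GH(2)[OF Pball[OF y]]]
      by (simp add: o_def)
    then have "(m has_derivative (\<lambda>v. - P (H (P y) (P v)))) (at y)"
      unfolding m_def by (auto intro!: derivative_eq_intros P.has_derivative)
    then show "(m has_derivative blinfun_apply (Dm y)) (at y)"
      by (simp add: Dm_def PL uminus_blinfun.rep_eq blinfun_compose.rep_eq o_def)
  next
    have "continuous_on (ball x r) (\<lambda>y. H (P y))"
      using Pball by (intro continuous_on_compose2[OF GH(3)] P.continuous_on continuous_intros) auto
    then show "continuous_on (ball x r) Dm" unfolding Dm_def
      by (intro continuous_on_minus bounded_bilinear.continuous_on[OF bounded_bilinear_blinfun_compose] continuous_on_const)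
  next
    fix q assume qM: "q \<in> M" and q: "q \<in> ball x r"
    have em: "e \<bullet> m q = 1" by (simp add: m_def inner_diff_right ee Psa[symmetric] Pe)
    have fP: "((\<lambda>y. f (P y)) has_derivative (\<lambda>v. G (P q) \<bullet> P v)) (at q)"
      using diff_chain_at[OF P.has_derivative[OF has_derivative_ident] GH(1)[OF Pball[OF q]]]
      by (simp add: o_def)
    obtain \<rho> where \<rho>: "\<rho> > 0" "ball q \<rho> \<subseteq> ball x r"
      using q openE[OF open_ball] by metis
    have "((\<lambda>y. e \<bullet> y - f (P y)) has_derivative (\<lambda>v. m q \<bullet> v)) (at q)"
      using fP by (auto intro!: derivative_eq_intros simp: m_def inner_diff_left Psa)
    then have "((\<lambda>y. e \<bullet> y - f (P y)) has_derivative (\<lambda>v. m q \<bullet> v)) (at q within M)"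
      by (rule has_derivative_at_withinI)
    then have A: "((\<lambda>_. 0) has_derivative (\<lambda>v. m q \<bullet> v)) (at q within M)"
      by (rule has_derivative_transform_within[OF _ \<rho>(1) qM])
         (use graph \<rho> in \<open>force simp: P_def dist_commute\<close>)
    have B: "\<exists>\<delta>>0. \<forall>\<tau>. m q \<bullet> \<tau> = 0 \<and> norm \<tau> < \<delta> \<longrightarrow> (\<exists>y\<in>M. norm (y - q - \<tau>) \<le> \<epsilon> * norm \<tau>)"
      if eps: "\<epsilon> > 0" for \<epsilon>
    proof -
      obtain \<delta>1 where \<delta>1: "\<delta>1 > 0" "\<And>y. norm (y - q) < \<delta>1 \<Longrightarrow>
          norm (f (P y) - f (P q) - G (P q) \<bullet> P (y - q)) \<le> min \<epsilon> 1 * norm (y - q)"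
        using fP eps unfolding has_derivative_at_alt by (metis zero_less_one min_less_iff_conj)
      show ?thesis
      proof (intro exI[of _ "min \<delta>1 (\<rho>/2)"] conjI allI impI)
        show "min \<delta>1 (\<rho>/2) > 0" using \<delta>1 \<rho> by simp
        fix \<tau> assume \<tau>: "m q \<bullet> \<tau> = 0 \<and> norm \<tau> < min \<delta>1 (\<rho>/2)"
        \<comment> \<open>The vertical correction that brings \<open>q + \<tau>\<close> back onto
          the graph. For \<open>\<tau>\<close> orthogonal to \<open>m q\<close> it equals the
          first-order Taylor remainder of \<open>f\<close>, hence is small relative to
          \<open>\<tau>\<close>.\<close>
        define \<gamma> where "\<gamma> = f (P (q + \<tau>)) - f (P q) - e \<bullet> \<tau>"
        have "e \<bullet> \<tau> = G (P q) \<bullet> P \<tau>" using \<tau> by (simp add: m_def inner_diff_left Psa)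
        then have g: "\<bar>\<gamma>\<bar> \<le> min \<epsilon> 1 * norm \<tau>"
          using \<delta>1(2)[of "q + \<tau>"] \<tau> by (simp add: \<gamma>_def)
        define y where "y = q + \<tau> + \<gamma> *\<^sub>R e"
        have yq: "norm (y - q - \<tau>) = \<bar>\<gamma>\<bar>" using e by (simp add: y_def)
        have "norm (y - q) \<le> norm \<tau> + \<bar>\<gamma>\<bar>" using norm_triangle_ineq[of \<tau> "\<gamma> *\<^sub>R e"] e
          by (simp add: y_def)
        also have "min \<epsilon> 1 * norm \<tau> \<le> 1 * norm \<tau>" by (intro mult_right_mono) auto
        then have "norm \<tau> + \<bar>\<gamma>\<bar> < \<rho>" using \<tau> g by linarith
        finally have "y \<in> ball x r" using \<rho>(2) by (auto simp: dist_norm norm_minus_commute subset_iff)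
        moreover have "P y = P (q + \<tau>)" by (simp add: y_def P.add P.scaleR Pe)
        moreover have "e \<bullet> q = f (P q)" using graph[OF q] qM by (simp add: P_def)
        ultimately have "y \<in> M" using graph[of y]
          unfolding P_def[symmetric] by (simp add: y_def inner_add_right ee \<gamma>_def)
        moreover have "min \<epsilon> 1 * norm \<tau> \<le> \<epsilon> * norm \<tau>" by (intro mult_right_mono) auto
        ultimately show "\<exists>y\<in>M. norm (y - q - \<tau>) \<le> \<epsilon> * norm \<tau>" using g yq
          by (intro bexI[of _ y]) auto
      qed
    qed
    show "hypersurface_normal M q (m q)" unfolding hypersurface_normal_def
      using A B em by auto
  qed
qed

section \<open>Normals of a convex core\<close>

text \<open>A step along \<open>n1 - n2\<close> points into the half-space of \<open>n1\<close> and
  out of that of \<open>n2\<close>, so a short one would end both inside and outside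
  \<open>S\<close>.\<close>

lemma is_inward_normal_unique:
  assumes n1: "is_inward_normal S x n1" and n2: "is_inward_normal S x n2"
  shows "n1 = n2"
proof (rule ccontr)
  assume ne: "n1 \<noteq> n2"
  have nn: "n1 \<bullet> n1 = 1" "n2 \<bullet> n2 = 1" using n1 n2 by (auto simp: is_inward_normal_def norm_eq_1)
  define h where "h = n1 - n2"
  have h: "h \<noteq> 0" using ne by (simp add: h_def)
  have hh: "n1 \<bullet> h = h \<bullet> h / 2" "n2 \<bullet> h = - (h \<bullet> h / 2)"
    using nn by (auto simp: h_def inner_diff_left inner_diff_right inner_commute field_simps)
  define \<epsilon> where "\<epsilon> = norm h / 4"
  have e0: "\<epsilon> > 0" using h by (simp add: \<epsilon>_def)
  have *: "n1 \<bullet> h > \<epsilon> * norm h" "n2 \<bullet> h < - \<epsilon> * norm h"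
    using h unfolding hh \<epsilon>_def by (simp_all add: power2_norm_eq_inner[symmetric] power2_eq_square)
  have "filterlim (\<lambda>t. x + t *\<^sub>R h) (at x) (at_right (0::real))"
    unfolding filterlim_at
  proof
    have "((\<lambda>t. x + t *\<^sub>R h) \<longlongrightarrow> x + 0 *\<^sub>R h) (at_right 0)" by (intro tendsto_intros)
    then show "((\<lambda>t. x + t *\<^sub>R h) \<longlongrightarrow> x) (at_right 0)" by simp
    show "\<forall>\<^sub>F t in at_right 0. x + t *\<^sub>R h \<in> UNIV \<and> x + t *\<^sub>R h \<noteq> x"
      using h unfolding eventually_at_right_field by (intro exI[of _ 1]) auto
  qed
  note lim = this
  have n12: "\<forall>\<^sub>F y in at x. (n1 \<bullet> (y - x) > \<epsilon> * norm (y - x) \<longrightarrow> y \<in> S) \<and>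
      (n2 \<bullet> (y - x) < - \<epsilon> * norm (y - x) \<longrightarrow> y \<notin> S)"
    using n1 n2 e0 unfolding is_inward_normal_def
    by (auto elim!: allE[of _ \<epsilon>] elim: eventually_elim2)
  have "\<forall>\<^sub>F t in at_right (0::real). (n1 \<bullet> (t *\<^sub>R h) > \<epsilon> * norm (t *\<^sub>R h) \<longrightarrow> x + t *\<^sub>R h \<in> S)
      \<and> (n2 \<bullet> (t *\<^sub>R h) < - \<epsilon> * norm (t *\<^sub>R h) \<longrightarrow> x + t *\<^sub>R h \<notin> S)"
    using eventually_compose_filterlim[OF n12 lim] by simp
  then have "\<forall>\<^sub>F t in at_right (0::real). 0 < t \<and> (n1 \<bullet> (t *\<^sub>R h) > \<epsilon> * norm (t *\<^sub>R h) \<longrightarrow> x + t *\<^sub>R h \<in> S)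
      \<and> (n2 \<bullet> (t *\<^sub>R h) < - \<epsilon> * norm (t *\<^sub>R h) \<longrightarrow> x + t *\<^sub>R h \<notin> S)"
    by (rule eventually_conj[OF eventually_at_right_less])
  from eventually_happens'[OF trivial_limit_at_right_real this]
  obtain t where t: "0 < t" "n1 \<bullet> (t *\<^sub>R h) > \<epsilon> * norm (t *\<^sub>R h) \<longrightarrow> x + t *\<^sub>R h \<in> S"
      "n2 \<bullet> (t *\<^sub>R h) < - \<epsilon> * norm (t *\<^sub>R h) \<longrightarrow> x + t *\<^sub>R h \<notin> S"
    by blast
  have "t * (n1 \<bullet> h) > t * (\<epsilon> * norm h)" "t * (n2 \<bullet> h) < t * (- \<epsilon> * norm h)"
    using t(1) * by (intro mult_strict_left_mono; simp)+
  with t show False by (simp add: algebra_simps)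
qed

lemma inward_normal_eqI: "is_inward_normal S x n \<Longrightarrow> inward_normal S x = n"
  unfolding inward_normal_def by (rule the_equality) (auto intro: is_inward_normal_unique)

text \<open>A supporting normal \<open>a\<close> at \<open>p\<close> is a multiple of \<open>m\<close>, because \<open>C\<close> contains points in all tangent
  directions. A point \<open>p + v\<close> with \<open>- a \<bullet> v > \<epsilon> * norm v\<close> is a convex combination of a boundary point
  near \<open>p\<close>, reached in a tangent direction, and a point of a fixed ball inside \<open>C\<close>.\<close>

lemma convex_hypersurface_normal:
  fixes C :: "'a::euclidean_space set"
  assumes C: "convex C" "closed C" "interior C \<noteq> {}"
    and p: "p \<in> frontier C" and hn: "hypersurface_normal (frontier C) p m"
  obtains a k where "norm a = 1" "\<And>x. x \<in> C \<Longrightarrow> a \<bullet> (x - p) \<le> 0"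
    "\<And>x. x \<in> interior C \<Longrightarrow> a \<bullet> (x - p) < 0"
    "is_inward_normal C p (- a)" "k \<noteq> 0" "a = k *\<^sub>R m"
proof -
  have ri: "rel_interior C = interior C" using C by (simp add: rel_interior_nonempty_interior)
  have "p \<in> C" "p \<notin> rel_interior C" using p ri C by (auto simp: frontier_def)
  then obtain b where b: "b \<noteq> 0" "\<And>y. y \<in> C \<Longrightarrow> b \<bullet> p \<le> b \<bullet> y"
      "\<And>y. y \<in> rel_interior C \<Longrightarrow> b \<bullet> p < b \<bullet> y"
    using supporting_hyperplane_rel_boundary[OF C(1)] by metis
  define a where "a = - b /\<^sub>R norm b"
  have na: "norm a = 1" using b by (simp add: a_def)
  have sup: "a \<bullet> (x - p) \<le> 0" if "x \<in> C" for x
    using b(2)[of x] that b(1)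
    by (auto simp: a_def inner_diff_right algebra_simps intro!: mult_left_mono)
  have sup': "a \<bullet> (x - p) < 0" if "x \<in> interior C" for x
    using b(3)[of x] that ri b(1) by (auto simp: a_def inner_diff_right algebra_simps)
  have m0: "m \<noteq> 0" and tan: "\<And>\<epsilon>. \<epsilon> > 0 \<Longrightarrow> \<exists>\<delta>>0. \<forall>\<tau>. m \<bullet> \<tau> = 0 \<and> norm \<tau> < \<delta> \<longrightarrow>
        (\<exists>y\<in>frontier C. norm (y - p - \<tau>) \<le> \<epsilon> * norm \<tau>)"
    using hn unfolding hypersurface_normal_def by auto
  have MC: "frontier C \<subseteq> C" using C by (simp add: frontier_subset_closed)
  have le: "a \<bullet> \<tau> \<le> 0" if \<tau>: "m \<bullet> \<tau> = 0" for \<tau>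
  proof (cases "\<tau> = 0")
    case False
    have "a \<bullet> \<tau> \<le> 0 + e" if e: "e > 0" for e
    proof -
      define \<epsilon> where "\<epsilon> = e / norm \<tau>"
      have "\<epsilon> > 0" using e False by (simp add: \<epsilon>_def)
      then obtain \<delta> where \<delta>: "\<delta> > 0" "\<And>\<tau>. m \<bullet> \<tau> = 0 \<Longrightarrow> norm \<tau> < \<delta> \<Longrightarrow>
        (\<exists>y\<in>frontier C. norm (y - p - \<tau>) \<le> \<epsilon> * norm \<tau>)" using tan by metis
      define t where "t = \<delta> / (2 * norm \<tau>)"
      have t: "t > 0" "norm (t *\<^sub>R \<tau>) < \<delta>" using \<delta> False by (auto simp: t_def)
      obtain y where y: "y \<in> frontier C" "norm (y - p - t *\<^sub>R \<tau>) \<le> \<epsilon> * norm (t *\<^sub>R \<tau>)"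
        using \<delta>(2)[of "t *\<^sub>R \<tau>"] t \<tau> by auto
      have "a \<bullet> (t *\<^sub>R \<tau>) = a \<bullet> (y - p) - a \<bullet> (y - p - t *\<^sub>R \<tau>)" by (simp add: inner_diff_right)
      also have "\<dots> \<le> 0 + norm a * norm (y - p - t *\<^sub>R \<tau>)"
        using sup[of y] y MC Cauchy_Schwarz_ineq2[of a "y - p - t *\<^sub>R \<tau>"] by (auto simp: subset_iff)
      also have "\<dots> \<le> \<epsilon> * norm (t *\<^sub>R \<tau>)" using y na by simp
      also have "\<dots> = t * e" using t False by (simp add: \<epsilon>_def)
      finally show ?thesis using t by simp
    qed
    then show ?thesis by (rule field_le_epsilon)
  qed simp
  have orth: "a \<bullet> \<tau> = 0" if "m \<bullet> \<tau> = 0" for \<tau>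
    using le[of \<tau>] le[of "- \<tau>"] that by simp
  define k where "k = (a \<bullet> m) / (m \<bullet> m)"
  have "m \<bullet> (a - k *\<^sub>R m) = 0" using m0 by (simp add: k_def inner_diff_right inner_commute)
  with orth[OF this] have "(a - k *\<^sub>R m) \<bullet> (a - k *\<^sub>R m) = 0"
    by (simp add: inner_diff_left)
  then have ak: "a = k *\<^sub>R m" by simp
  with na have k: "k \<noteq> 0" by auto
  have in1: "\<forall>\<^sub>F y in at p. - a \<bullet> (y - p) > \<epsilon> * norm (y - p) \<longrightarrow> y \<in> C" if eps: "\<epsilon> > 0" for \<epsilon>
  proof -
    obtain x0 where x0: "x0 \<in> interior C" using C by auto
    then obtain \<rho> where \<rho>: "\<rho> > 0" "cball x0 \<rho> \<subseteq> C" by (auto simp: mem_interior_cball)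
    define \<kappa> where "\<kappa> = - a \<bullet> (x0 - p)"
    have \<kappa>: "\<kappa> > 0" using sup'[OF x0] by (simp add: \<kappa>_def)
    define K where "K = 1 + norm (x0 - p) / \<kappa>"
    have K: "K > 0" using \<kappa> by (simp add: K_def add_pos_nonneg)
    \<comment> \<open>Calibrated so that the error \<open>h\<close> below is at most
      \<open>\<rho> * \<beta>\<close>; after division by the weight \<open>\<beta>\<close> of
      \<open>x0\<close> it fits into the ball of radius \<open>\<rho>\<close>.\<close>
    define \<eta> where "\<eta> = \<rho> * \<epsilon> / (2 * K * \<kappa>)"
    have \<eta>: "\<eta> > 0" using \<rho> eps K \<kappa> by (simp add: \<eta>_def)
    obtain \<delta> where \<delta>: "\<delta> > 0" "\<And>\<tau>. m \<bullet> \<tau> = 0 \<Longrightarrow> norm \<tau> < \<delta> \<Longrightarrow>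
        (\<exists>y\<in>frontier C. norm (y - p - \<tau>) \<le> \<eta> * norm \<tau>)" using tan[OF \<eta>] by metis
    have "y \<in> C" if y: "y \<noteq> p" "dist y p < min (\<kappa> / 2) (\<delta> / (2 * K))"
      and gt: "- a \<bullet> (y - p) > \<epsilon> * norm (y - p)" for y
    proof -
      define v where "v = y - p"
      have v: "v \<noteq> 0" "norm v < \<kappa> / 2" "norm v < \<delta> / (2 * K)"
        using y by (auto simp: v_def dist_norm)
      \<comment> \<open>The weight of \<open>x0\<close> for which
        \<open>v - \<beta> *\<^sub>R (x0 - p)\<close> is tangent.\<close>
      define \<beta> where "\<beta> = (- a \<bullet> v) / \<kappa>"
      have "\<epsilon> * norm v < - a \<bullet> v" using gt by (simp add: v_def)
      then have \<beta>1: "\<beta> \<ge> \<epsilon> * norm v / \<kappa>" unfolding \<beta>_def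
        using \<kappa> by (intro divide_right_mono) auto
      have "0 < \<epsilon> * norm v / \<kappa>" using eps v \<kappa> by simp
      with \<beta>1 have \<beta>0: "\<beta> > 0" by linarith
      have "- a \<bullet> v \<le> norm v" using norm_cauchy_schwarz[of "- a" v] na by simp
      then have \<beta>2: "\<beta> \<le> norm v / \<kappa>" unfolding \<beta>_def using \<kappa> by (intro divide_right_mono) auto
      also have "\<dots> < 1/2" using v \<kappa> by (simp add: field_simps)
      finally have \<beta>3: "\<beta> < 1/2" .
      define \<tau> where "\<tau> = v - \<beta> *\<^sub>R (x0 - p)"
      have "\<beta> * \<kappa> = - a \<bullet> v" using \<kappa> by (simp add: \<beta>_def)
      moreover have "a \<bullet> \<tau> = a \<bullet> v + \<beta> * \<kappa>" 
        by (simp add: \<tau>_def \<kappa>_def inner_diff_right algebra_simps)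
      ultimately have "a \<bullet> \<tau> = 0" by simp
      then have m\<tau>: "m \<bullet> \<tau> = 0" using ak k by simp
      have "norm \<tau> \<le> norm v + \<beta> * norm (x0 - p)"
        using norm_triangle_ineq4[of v "\<beta> *\<^sub>R (x0 - p)"] \<beta>0 by (simp add: \<tau>_def)
      also have "\<dots> \<le> norm v + norm v / \<kappa> * norm (x0 - p)"
        using \<beta>2 by (intro add_left_mono mult_right_mono) auto
      also have "\<dots> = K * norm v" by (simp add: K_def algebra_simps)
      finally have n\<tau>: "norm \<tau> \<le> K * norm v" .
      \<comment> \<open>Rescaled so that \<open>y\<close> is the convex combination of
        \<open>p + \<tau>'\<close> and \<open>x0\<close> with weights \<open>1 - \<beta>\<close> and
        \<open>\<beta>\<close>.\<close>
      define \<tau>' where "\<tau>' = \<tau> /\<^sub>R (1 - \<beta>)"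
      have "norm \<tau>' = norm \<tau> / (1 - \<beta>)" using \<beta>3 by (simp add: \<tau>'_def field_simps)
      also have "\<dots> \<le> norm \<tau> / (1/2)" using \<beta>3 by (intro divide_left_mono) auto
      finally have n\<tau>': "norm \<tau>' \<le> 2 * K * norm v" using n\<tau> by simp
      have "2 * K * norm v < \<delta>" using v K by (simp add: field_simps)
      with n\<tau>' obtain z where z: "z \<in> frontier C" "norm (z - p - \<tau>') \<le> \<eta> * norm \<tau>'"
        using \<delta>(2)[of \<tau>'] m\<tau> by (auto simp: \<tau>'_def)
      define h where "h = z - p - \<tau>'"
      \<comment> \<open>The boundary point \<open>z\<close> misses \<open>p + \<tau>'\<close> by
        \<open>h\<close>; shifting \<open>x0\<close> by \<open>h'\<close> cancels this in the
        combination, since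
        \<open>(1 - \<beta>) *\<^sub>R h + \<beta> *\<^sub>R h' = 0\<close>.\<close>
      define h' where "h' = - ((1 - \<beta>) / \<beta>) *\<^sub>R h"
      have "norm h \<le> \<eta> * (2 * K * norm v)"
        using z n\<tau>' \<eta> by (auto simp: h_def intro: order_trans mult_left_mono)
      also have "\<dots> = \<rho> * (\<epsilon> * norm v / \<kappa>)" using K by (simp add: \<eta>_def)
      also have "\<dots> \<le> \<rho> * \<beta>" using \<beta>1 \<rho> by (intro mult_left_mono) auto
      finally have nh: "norm h \<le> \<rho> * \<beta>" .
      have \<beta>h: "\<beta> *\<^sub>R h' = - ((1 - \<beta>) *\<^sub>R h)" using \<beta>0 by (simp add: h'_def)
      have "norm h' = (1 - \<beta>) * (norm h / \<beta>)" using \<beta>0 \<beta>3 by (simp add: h'_def)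
      also have "\<dots> \<le> 1 * (norm h / \<beta>)" using \<beta>0 by (intro mult_right_mono) auto
      also have "\<dots> \<le> \<rho>" using nh \<beta>0 by (simp add: field_simps)
      finally have "x0 + h' \<in> cball x0 \<rho>" by (simp add: dist_norm)
      then have "x0 + h' \<in> C" using \<rho> by auto
      moreover have "z \<in> C" using z MC by auto
      ultimately have "(1 - \<beta>) *\<^sub>R z + \<beta> *\<^sub>R (x0 + h') \<in> C"
        using \<beta>0 \<beta>3 by (intro convexD[OF C(1)]) auto
      also have "(1 - \<beta>) *\<^sub>R z + \<beta> *\<^sub>R (x0 + h') = (1 - \<beta>) *\<^sub>R (z - h) + \<beta> *\<^sub>R x0"
        by (simp add: scaleR_add_right \<beta>h scaleR_diff_right)
      also have "\<dots> = (1 - \<beta>) *\<^sub>R p + (1 - \<beta>) *\<^sub>R \<tau>' + \<beta> *\<^sub>R x0" by (simp add: h_def algebra_simps)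
      also have "(1 - \<beta>) *\<^sub>R \<tau>' = \<tau>" using \<beta>3 by (simp add: \<tau>'_def)
      also have "(1 - \<beta>) *\<^sub>R p + \<tau> + \<beta> *\<^sub>R x0 = y" by (simp add: \<tau>_def v_def algebra_simps)
      finally show ?thesis .
    qed
    then show ?thesis unfolding eventually_at
      by (intro exI[of _ "min (\<kappa> / 2) (\<delta> / (2 * K))"]) (use \<kappa> \<delta> K in auto)
  qed
  have in2: "y \<notin> C" if "- a \<bullet> (y - p) < - \<epsilon> * norm (y - p)" "\<epsilon> > 0" for y \<epsilon>
  proof
    assume "y \<in> C"
    from sup[OF this] that have "\<epsilon> * norm (y - p) < 0" by simp
    then show False using that(2) by (simp add: mult_less_0_iff)
  qed
  have "is_inward_normal C p (- a)"
    unfolding is_inward_normal_def using p na in1 in2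
    by (auto intro: eventually_conj elim!: eventually_mono[OF in1])
  from that[OF na sup sup' this k ak] show ?thesis .
qed

section \<open>The unit normal field of the core\<close>

locale smooth_core =
  fixes C :: "'a::euclidean_space set"
  assumes core: "convex_core C"
begin

abbreviation "M \<equiv> frontier C"
abbreviation "\<nu> \<equiv> outward_normal C"

lemma core_props: "compact C" "convex C" "closed C" "interior C \<noteq> {}" "C \<noteq> {}" "M \<subseteq> C"
    "C2_hypersurface M"
proof -
  show c: "compact C" "convex C" "interior C \<noteq> {}" "C2_hypersurface M"
    using core by (simp_all add: convex_core_def)
  then show "closed C" "C \<noteq> {}" "M \<subseteq> C"
    by (auto simp: compact_imp_closed frontier_subset_closed)
qed

text \<open>One fixed interior point \<open>x0\<close> decides which of the two unit multiples of
  \<open>m\<close> points outward. The resulting formula lets \<open>\<nu>\<close> inherit the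
  regularity of the chart field \<open>m\<close>.\<close>

lemma outward_normal_eq:
  assumes p: "p \<in> M" and hn: "hypersurface_normal M p m" and x0: "x0 \<in> interior C"
  shows "norm (\<nu> p) = 1" "x \<in> C \<Longrightarrow> \<nu> p \<bullet> (x - p) \<le> 0" "is_inward_normal C p (- \<nu> p)"
    "hypersurface_normal M p (\<nu> p)" "\<nu> p = (- sgn (m \<bullet> (x0 - p)) / norm m) *\<^sub>R m"
    "m \<bullet> (x0 - p) \<noteq> 0"
proof -
  obtain a k where a: "norm a = 1" "\<And>x. x \<in> C \<Longrightarrow> a \<bullet> (x - p) \<le> 0"
    "\<And>x. x \<in> interior C \<Longrightarrow> a \<bullet> (x - p) < 0"
    "is_inward_normal C p (- a)" "k \<noteq> 0" "a = k *\<^sub>R m"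
    using convex_hypersurface_normal[OF core_props(2-4) p hn] by metis
  have [simp]: "\<nu> p = a" using inward_normal_eqI[OF a(4)] by (simp add: outward_normal_def)
  show "norm (\<nu> p) = 1" "x \<in> C \<Longrightarrow> \<nu> p \<bullet> (x - p) \<le> 0" "is_inward_normal C p (- \<nu> p)" using a by auto
  show "hypersurface_normal M p (\<nu> p)" using hypersurface_normal_scaleR[OF hn a(5)] a(6) by simp
  have "k * (m \<bullet> (x0 - p)) < 0" using a(3)[OF x0] a(6) by simp
  have nm: "norm m > 0" using hn by (simp add: hypersurface_normal_def)
  have "\<bar>k\<bar> * norm m = 1" using a by auto
  then have k: "\<bar>k\<bar> = 1 / norm m" using nm by (simp add: eq_divide_eq)
  have "- sgn (m \<bullet> (x0 - p)) = sgn k"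
    using \<open>k * (m \<bullet> (x0 - p)) < 0\<close> by (auto simp: mult_less_0_iff sgn_if)
  with k show "\<nu> p = (- sgn (m \<bullet> (x0 - p)) / norm m) *\<^sub>R m" "m \<bullet> (x0 - p) \<noteq> 0"
    using a(6) \<open>k * (m \<bullet> (x0 - p)) < 0\<close> by (auto simp: sgn_if abs_if split: if_splits)
qed

lemma outward_normal:
  assumes p: "p \<in> M"
  shows norm_outward_normal: "norm (\<nu> p) = 1"
    and outward_normal_support: "x \<in> C \<Longrightarrow> \<nu> p \<bullet> (x - p) \<le> 0"
    and is_inward_normal_core: "is_inward_normal C p (- \<nu> p)"
    and hypersurface_normal_outward: "hypersurface_normal M p (\<nu> p)"
proof -
  obtain x0 where "x0 \<in> interior C" using core_props by auto
  moreover obtain m where "hypersurface_normal M p m"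
    using C2_hypersurface_chart[OF core_props(7) p] p by (metis centre_in_ball)
  ultimately show "norm (\<nu> p) = 1" "x \<in> C \<Longrightarrow> \<nu> p \<bullet> (x - p) \<le> 0" "is_inward_normal C p (- \<nu> p)"
    "hypersurface_normal M p (\<nu> p)"
    using outward_normal_eq[OF p] by auto
qed

lemma outward_normal_unit [simp]: "p \<in> M \<Longrightarrow> \<nu> p \<bullet> \<nu> p = 1"
  using norm_outward_normal by (simp add: norm_eq_1)

end

section \<open>Extension of the normal field to an ambient ball\<close>

context smooth_core
begin

text \<open>Normalising the chart field gives a unit field on an open set, where derivatives are
  unique and identities such as \<open>N y \<bullet> N y = 1\<close> can be differentiated.
  Continuity of \<open>DN\<close> is stated vector by vector; finite dimension later makes it
  uniform.\<close>

lemma smooth_normal_extension: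
  assumes c: "c \<in> M"
  obtains r N and DN :: "'a \<Rightarrow> 'a \<Rightarrow> 'a" where "r > 0"
    "\<And>y. y \<in> ball c r \<Longrightarrow> norm (N y) = 1"
    "\<And>y. y \<in> ball c r \<Longrightarrow> (N has_derivative DN y) (at y)"
    "\<And>v. continuous_on (ball c r) (\<lambda>y. DN y v)"
    "\<And>q. q \<in> M \<Longrightarrow> q \<in> ball c r \<Longrightarrow> N q = \<nu> q"
proof -
  obtain r m and Dm :: "'a \<Rightarrow> 'a \<Rightarrow>\<^sub>L 'a" where r: "r > 0"
    and m0: "\<And>y. y \<in> ball c r \<Longrightarrow> m y \<noteq> 0"
    and dm: "\<And>y. y \<in> ball c r \<Longrightarrow> (m has_derivative blinfun_apply (Dm y)) (at y)"
    and cDm: "continuous_on (ball c r) Dm"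
    and hn: "\<And>q. q \<in> M \<Longrightarrow> q \<in> ball c r \<Longrightarrow> hypersurface_normal M q (m q)"
    using C2_hypersurface_chart[OF core_props(7) c] by metis
  obtain x0 where x0: "x0 \<in> interior C" using core_props by auto
  have cm: "continuous_on (ball c r) m"
    using dm by (intro continuous_at_imp_continuous_on ballI has_derivative_continuous) auto
  \<comment> \<open>The sign is frozen at \<open>c\<close>; by continuity it is the right one at all
    nearby points of \<open>M\<close>.\<close>
  define \<sigma> where "\<sigma> = - sgn (m c \<bullet> (x0 - c))"
  have mc: "m c \<bullet> (x0 - c) \<noteq> 0" using outward_normal_eq(6)[OF c hn x0] c r by simp
  then have \<sigma>: "\<bar>\<sigma>\<bar> = 1" and "\<sigma> * (m c \<bullet> (x0 - c)) < 0"
    by (auto simp: \<sigma>_def sgn_if)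
  moreover have "isCont (\<lambda>y. \<sigma> * (m y \<bullet> (x0 - y))) c"
    using dm[of c] r by (intro continuous_intros) (auto intro: has_derivative_continuous)
  then have "((\<lambda>y. \<sigma> * (m y \<bullet> (x0 - y))) \<longlongrightarrow> \<sigma> * (m c \<bullet> (x0 - c))) (nhds c)"
    using tendsto_at_iff_tendsto_nhds[of "\<lambda>y. \<sigma> * (m y \<bullet> (x0 - y))" c] by (simp only: isCont_def)
  ultimately have "\<forall>\<^sub>F y in nhds c. \<sigma> * (m y \<bullet> (x0 - y)) < 0"
    by (intro order_tendstoD)
  then obtain s where s: "s > 0" "\<And>y. dist y c < s \<Longrightarrow> \<sigma> * (m y \<bullet> (x0 - y)) < 0"
    unfolding eventually_nhds_metric by auto
  define N where "N y = \<sigma> *\<^sub>R (m y /\<^sub>R norm (m y))" for y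
  define DN where "DN y v = \<sigma> *\<^sub>R (Dm y v /\<^sub>R norm (m y) -
     ((m y \<bullet> Dm y v) / norm (m y) ^ 3) *\<^sub>R m y)" for y v
  show ?thesis
  proof (rule that[of "min r s" N DN])
    show "min r s > 0" using r s by simp
    fix y assume y: "y \<in> ball c (min r s)"
    then have [simp]: "m y \<noteq> 0" using m0 by simp
    show "norm (N y) = 1" using \<sigma> by (simp add: N_def abs_mult)
    have "((\<lambda>y. norm (m y)) has_derivative (\<lambda>v. Dm y v \<bullet> sgn (m y))) (at y)"
      using diff_chain_at[OF dm has_derivative_norm, of y] y by (simp add: o_def)
    from Deriv.has_derivative_inverse[OF _ this]
    have di: "((\<lambda>y. inverse (norm (m y))) has_derivative
        (\<lambda>v. - (inverse (norm (m y)) * (Dm y v \<bullet> sgn (m y)) * inverse (norm (m y))))) (at y)"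
      by simp
    show "(N has_derivative DN y) (at y)" unfolding N_def
      by (rule has_derivative_eq_rhs[OF has_derivative_scaleR_right[OF has_derivative_scaleR[OF di dm]]])
         (use y in \<open>auto simp: DN_def fun_eq_iff sgn_div_norm inner_commute power3_eq_cube
            divide_inverse algebra_simps\<close>)
  next
    fix v
    have "continuous_on (ball c r) (\<lambda>y. Dm y v)" by (intro blinfun.continuous_on cDm continuous_on_const)
    note Dmv = this
    have "continuous_on (ball c r) (\<lambda>y. DN y v)" unfolding DN_def
      using m0 by (intro continuous_on_diff continuous_on_scaleR continuous_on_divide continuous_on_inverse
          continuous_on_inner continuous_on_norm continuous_on_power continuous_on_const cm Dmv) auto
    then show "continuous_on (ball c (min r s)) (\<lambda>y. DN y v)"
      by (rule continuous_on_subset) auto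
  next
    fix q assume q: "q \<in> M" "q \<in> ball c (min r s)"
    then have "\<sigma> * (m q \<bullet> (x0 - q)) < 0" using s by (simp add: dist_commute)
    then have "- sgn (m q \<bullet> (x0 - q)) = \<sigma>" using \<sigma> by (auto simp: mult_less_0_iff sgn_if)
    then show "N q = \<nu> q" using outward_normal_eq(5)[OF q(1) hn x0] q
      by (simp add: N_def divide_inverse)
  qed
qed

section \<open>Nearest-point projection onto the core\<close>

abbreviation "P \<equiv> closest_point C"

lemma closest_point_offset:
  assumes p: "p \<in> M" and s: "s \<ge> 0"
  shows "P (p + s *\<^sub>R \<nu> p) = p"
proof (rule closest_point_unique[OF core_props(2,3), symmetric])
  show "p \<in> C" using p core_props by auto
  show "\<forall>z\<in>C. dist (p + s *\<^sub>R \<nu> p) p \<le> dist (p + s *\<^sub>R \<nu> p) z"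
  proof
    fix z assume "z \<in> C"
    then have "\<nu> p \<bullet> (z - p) \<le> 0" by (rule outward_normal_support[OF p])
    then have "s \<le> \<nu> p \<bullet> (p + s *\<^sub>R \<nu> p - z)"
      using p by (simp add: inner_diff_right inner_add_right)
    also have "\<dots> \<le> norm (p + s *\<^sub>R \<nu> p - z)"
      using norm_cauchy_schwarz[of "\<nu> p"] p norm_outward_normal by (metis mult_1)
    finally show "dist (p + s *\<^sub>R \<nu> p) p \<le> dist (p + s *\<^sub>R \<nu> p) z"
      using s p by (simp add: dist_norm norm_outward_normal)
  qed
qed

lemma offset_notin_core:
  assumes p: "p \<in> M" and s: "s > 0"
  shows "p + s *\<^sub>R \<nu> p \<notin> C"
  using outward_normal_support[OF p, of "p + s *\<^sub>R \<nu> p"] s p by auto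

text \<open>If the direction \<open>u\<close> of \<open>y - P y\<close> differed from the outward
  normal, then \<open>u - \<nu> (P y)\<close> would make an acute angle both with the inward normal
  and with \<open>u\<close>: a small step along it would stay in \<open>C\<close> and violate the
  obtuse-angle property of the nearest point.\<close>

lemma closest_point_frontier:
  assumes y: "y \<notin> C"
  shows "P y \<in> M" "y = P y + dist y (P y) *\<^sub>R \<nu> (P y)"
proof -
  have PC: "P y \<in> C" using closest_point_in_set[OF core_props(3,5)] .
  have "P y \<notin> interior C" 
    using closest_point_in_rel_interior[OF core_props(3,5), of y] y interior_subset[of C] core_props(4)
    by (auto simp: rel_interior_nonempty_interior affine_hull_nonempty_interior)
  then show PM: "P y \<in> M" using PC closure_subset by (auto simp: frontier_def)
  define u where "u = sgn (y - P y)"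
  have yP: "y - P y \<noteq> 0" using PC y by auto
  then have u1: "norm u = 1" "y - P y = dist y (P y) *\<^sub>R u"
    by (auto simp: u_def norm_sgn dist_norm sgn_div_norm)
  have "u = \<nu> (P y)"
  proof (rule ccontr)
    assume ne: "u \<noteq> \<nu> (P y)"
    let ?n = "- \<nu> (P y)"
    define h where "h = u - \<nu> (P y)"
    have h0: "h \<noteq> 0" using ne by (simp add: h_def)
    have uu: "u \<bullet> u = 1" using u1 by (simp add: norm_eq_1)
    have hh: "u \<bullet> h = h \<bullet> h / 2" "?n \<bullet> h = h \<bullet> h / 2"
      using uu PM by (auto simp: h_def inner_diff_left inner_diff_right inner_commute field_simps)
    define \<epsilon> where "\<epsilon> = norm h / 4"
    have "\<epsilon> > 0" using h0 by (simp add: \<epsilon>_def)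
    then have "\<forall>\<^sub>F x in at (P y). ?n \<bullet> (x - P y) > \<epsilon> * norm (x - P y) \<longrightarrow> x \<in> C"
      using is_inward_normal_core[OF PM] unfolding is_inward_normal_def
      by (auto elim!: allE[of _ \<epsilon>] elim: eventually_mono)
    then obtain \<delta> where \<delta>: "\<delta> > 0" "\<And>x. x \<noteq> P y \<Longrightarrow> dist x (P y) < \<delta> \<Longrightarrow>
        ?n \<bullet> (x - P y) > \<epsilon> * norm (x - P y) \<Longrightarrow> x \<in> C"
      unfolding eventually_at by auto
    define t where "t = \<delta> / (2 * norm h)"
    have t: "t > 0" "t * norm h < \<delta>" using \<delta> h0 by (auto simp: t_def)
    have "\<epsilon> * norm h < h \<bullet> h / 2"
      using h0 by (simp add: \<epsilon>_def power2_norm_eq_inner[symmetric] power2_eq_square)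
    then have "t * (\<epsilon> * norm h) < t * (?n \<bullet> h)" using t hh by (intro mult_strict_left_mono) auto
    then have "P y + t *\<^sub>R h \<in> C" using t h0
      by (intro \<delta>(2)) (auto simp: dist_norm algebra_simps)
    from closest_point_dot[OF core_props(2,3) this, of y]
    have "t * (dist y (P y) * (u \<bullet> h)) \<le> 0" by (subst (asm) u1(2)) simp
    moreover have "u \<bullet> h > 0" unfolding hh using h0 by simp
    ultimately show False using t yP by (auto simp: mult_le_0_iff not_le)
  qed
  then show "y = P y + dist y (P y) *\<^sub>R \<nu> (P y)" using u1 by (simp add: algebra_simps)
qed

end

section \<open>Gradient and Hessian on the boundary\<close>

context smooth_core
begin

abbreviation "T \<equiv> tangent_space C"

text \<open>\<open>frechet_derivative\<close> selects some derivative within \<open>M\<close>;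
  uniqueness on tangent vectors makes the selection harmless there.\<close>

lemma boundary_differential_eq:
  assumes c: "c \<in> M" and f: "(f has_derivative D) (at c within M)" and v: "v \<in> T c"
  shows "boundary_differential C f c v = D v"
proof -
  have "f differentiable (at c within M)" using f by (auto simp: differentiable_def)
  then have "(f has_derivative boundary_differential C f c) (at c within M)"
    unfolding boundary_differential_def by (simp add: frechet_derivative_works)
  from has_derivative_eq_on_tangents[OF hypersurface_normal_outward[OF c] this f]
  show ?thesis using v by (simp add: tangent_space_def)
qed

lemma riemannian_gradient_eqI:
  assumes q: "q \<in> M" and f: "(f has_derivative (\<lambda>v. g \<bullet> v)) (at q within M)" and g: "g \<in> T q"
  shows "riemannian_gradient C f q = g"
  unfolding riemannian_gradient_def
proof (rule the_equality)
  fix g' assume g': "g' \<in> T q \<and> (f has_derivative (\<lambda>v. g' \<bullet> v)) (at q within M)"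
  then have "\<nu> q \<bullet> (g' - g) = 0" using g by (simp add: tangent_space_def inner_diff_right)
  from has_derivative_eq_on_tangents[OF hypersurface_normal_outward[OF q] conjunct2[OF g'] f this]
  have "(g' - g) \<bullet> (g' - g) = 0" by (simp add: inner_diff_left)
  then show "g' = g" by simp
qed (use f g in auto)

text \<open>\<open>G\<close> is the ambient gradient of a local extension of \<open>f\<close>, made
  tangential by means of the extended normal \<open>N\<close>. It lives on an open set, so the
  Hessian can be read off from an ordinary derivative of \<open>G\<close> at
  \<open>c\<close>.\<close>

lemma gradient_extension:
  assumes c: "c \<in> M" and f: "C2_on_hypersurface M f" and crit: "riemannian_gradient C f c = 0"
  obtains r G DG where "r > 0"
    "\<And>q. q \<in> M \<Longrightarrow> q \<in> ball c r \<Longrightarrow> (f has_derivative (\<lambda>v. G q \<bullet> v)) (at q within M)"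
    "\<And>q. q \<in> M \<Longrightarrow> q \<in> ball c r \<Longrightarrow> \<nu> q \<bullet> G q = 0"
    "G c = 0" "(G has_derivative DG) (at c)" "\<And>v. \<nu> c \<bullet> DG v = 0"
    "\<And>v. v \<in> T c \<Longrightarrow> riemannian_hessian C f c v = DG v"
proof -
  obtain r N DN where r: "r > 0"
    and N1: "\<And>y. y \<in> ball c r \<Longrightarrow> norm (N y) = 1"
    and dN: "\<And>y. y \<in> ball c r \<Longrightarrow> (N has_derivative DN y) (at y)"
    and N\<nu>: "\<And>q. q \<in> M \<Longrightarrow> q \<in> ball c r \<Longrightarrow> N q = \<nu> q"
    using smooth_normal_extension[OF c] by metis
  obtain U g where U: "open U" "c \<in> U" "C2_on U g" "\<And>y. y \<in> M \<inter> U \<Longrightarrow> f y = g y"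
    using f c unfolding C2_on_hypersurface_def by metis
  obtain \<gamma> and H :: "'a \<Rightarrow> 'a \<Rightarrow>\<^sub>L 'a" where \<gamma>: "\<And>x. x \<in> U \<Longrightarrow> (g has_derivative (\<lambda>v. \<gamma> x \<bullet> v)) (at x)"
    and H: "\<And>x. x \<in> U \<Longrightarrow> (\<gamma> has_derivative blinfun_apply (H x)) (at x)"
    using U(3) unfolding C2_on_def by metis
  obtain s where s: "s > 0" "ball c s \<subseteq> U" using U openE by metis
  define t where "t = min r s"
  have t: "t > 0" "ball c t \<subseteq> U" "ball c t \<subseteq> ball c r" using r s by (auto simp: t_def)
  have ct: "c \<in> ball c t" using t by simp
  define G where "G y = \<gamma> y - (N y \<bullet> \<gamma> y) *\<^sub>R N y" for y
  have NN: "N y \<bullet> N y = 1" if "y \<in> ball c t" for y using N1 that t by (auto simp: norm_eq_1[symmetric])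
  have NG: "N y \<bullet> G y = 0" if "y \<in> ball c t" for y
    using NN[OF that] by (simp add: G_def inner_diff_right)
  have fG: "(f has_derivative (\<lambda>v. G q \<bullet> v)) (at q within M)" if q: "q \<in> M" "q \<in> ball c t" for q
  proof -
    obtain \<rho> where \<rho>: "\<rho> > 0" "ball q \<rho> \<subseteq> ball c t" using q openE[OF open_ball] by metis
    have "(g has_derivative (\<lambda>v. \<gamma> q \<bullet> v)) (at q within M)"
      by (rule has_derivative_at_withinI[OF \<gamma>]) (use q t(2) in auto)
    then have "(f has_derivative (\<lambda>v. \<gamma> q \<bullet> v)) (at q within M)"
      by (rule has_derivative_transform_within[OF _ \<rho>(1) q(1)])
         (use \<rho>(2) t(2) in \<open>auto intro!: U(4)[symmetric] simp: dist_commute subset_iff\<close>)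
    then show ?thesis
      by (rule has_derivative_tangent_cong[OF hypersurface_normal_outward[OF q(1)] _ bounded_linear_inner_right])
         (use N\<nu> q t in \<open>auto simp: G_def inner_diff_left\<close>)
  qed
  have \<nu>G: "\<nu> q \<bullet> G q = 0" if q: "q \<in> M" "q \<in> ball c t" for q
    using NG[OF q(2)] N\<nu>[OF q(1)] q t by auto
  have rg: "riemannian_gradient C f q = G q" if q: "q \<in> M" "q \<in> ball c t" for q
    using fG[OF q] \<nu>G[OF q] by (intro riemannian_gradient_eqI q) (auto simp: tangent_space_def)
  have Gc: "G c = 0" using rg[OF c ct] crit by simp
  define DG where "DG v = H c v - ((N c \<bullet> \<gamma> c) *\<^sub>R DN c v + (N c \<bullet> H c v + DN c v \<bullet> \<gamma> c) *\<^sub>R N c)" for v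
  have dG: "(G has_derivative DG) (at c)" unfolding G_def DG_def
    using dN[of c] H[of c] U(2) r by (auto intro!: derivative_eq_intros)
  \<comment> \<open>Differentiating \<open>N y \<bullet> G y = 0\<close> at \<open>c\<close>, the
    term with \<open>DN\<close> drops out because \<open>G c = 0\<close>. Hence the tangential
    projection in the Hessian changes nothing at a critical point.\<close>
  have \<nu>DG: "\<nu> c \<bullet> DG v = 0" for v
  proof -
    have "((\<lambda>y. N y \<bullet> G y) has_derivative (\<lambda>v. N c \<bullet> DG v + DN c v \<bullet> G c)) (at c)"
      using dN[of c] r dG by (intro has_derivative_inner) auto
    then have "((\<lambda>y. 0) has_derivative (\<lambda>v. N c \<bullet> DG v + DN c v \<bullet> G c)) (at c)"
      by (rule has_derivative_transform_within[OF _ t(1)])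
         (use NG in \<open>auto simp: dist_commute\<close>)
    from has_derivative_unique[OF this has_derivative_const]
    have "N c \<bullet> DG v = 0" using Gc by (simp add: fun_eq_iff)
    then show ?thesis using N\<nu>[OF c] r by simp
  qed
  have "riemannian_hessian C f c v = DG v" if v: "v \<in> T c" for v
  proof -
    have "(riemannian_gradient C f has_derivative DG) (at c within M)"
      by (rule has_derivative_transform_within[OF has_derivative_at_withinI[OF dG] t(1) c])
         (use rg in \<open>auto simp: dist_commute\<close>)
    from boundary_differential_eq[OF c this v] show ?thesis
      using \<nu>DG by (simp add: riemannian_hessian_def tangential_part_def)
  qed
  from that[OF t(1) fG \<nu>G Gc dG \<nu>DG this] show ?thesis .
qed

text \<open>\<open>geometric_operator\<close> uses \<open>inv_into\<close>, so surjectivity of \<open>I - d S\<close> must be proved: outside the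
  image, \<open>inv_into\<close> would take one and the same junk value at \<open>v\<close> and at \<open>2 *\<^sub>R v\<close>, which isotropy excludes.\<close>

lemma isotropic_shape:
  assumes iso: "isotropic_return C \<Omega> c \<alpha>" and v0: "v0 \<in> T c" "v0 \<noteq> 0"
    and dN: "(\<nu> has_derivative D) (at c within M)"
  shows "thickness C \<Omega> c > 0"
    "\<And>v. v \<in> T c \<Longrightarrow> v + thickness C \<Omega> c *\<^sub>R D v = (2 * thickness C \<Omega> c / \<alpha>) *\<^sub>R v"
proof -
  define d where "d = thickness C \<Omega> c"
  define f where "f w = w - d *\<^sub>R shape_operator C c w" for w
  interpret D: bounded_linear D using dN by (rule has_derivative_bounded_linear)
  have c: "c \<in> M" and \<alpha>: "\<alpha> > 0" and bdd: "bdd_above (thickness_radii C \<Omega> c)"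
    and A: "\<And>v. v \<in> T c \<Longrightarrow> (2 * d) *\<^sub>R inv_into (T c) f v = \<alpha> *\<^sub>R v"
    using iso unfolding isotropic_return_def nondegenerate_critical_point_def finite_thickness_def
      geometric_operator_def f_def d_def by auto
  have fD: "f w = w + d *\<^sub>R D w" if "w \<in> T c" for w
    using boundary_differential_eq[OF c dN that] by (simp add: f_def shape_operator_def)
  have "d \<ge> 0" unfolding d_def thickness_def using bdd by (intro cSup_upper) auto
  moreover have "d \<noteq> 0" using A[OF v0(1)] v0(2) \<alpha> by auto
  ultimately show d: "thickness C \<Omega> c > 0" by (simp add: d_def)
  have T: "t *\<^sub>R w \<in> T c" if "w \<in> T c" for w t using that by (simp add: tangent_space_def)
  fix v assume v: "v \<in> T c"
  have "v \<in> f ` T c"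
  proof (rule ccontr)
    assume nv: "v \<notin> f ` T c"
    have n2: "2 *\<^sub>R v \<notin> f ` T c"
    proof
      assume "2 *\<^sub>R v \<in> f ` T c"
      then obtain w where w: "w \<in> T c" "2 *\<^sub>R v = f w" by auto
      have "f ((1/2) *\<^sub>R w) = (1/2) *\<^sub>R f w" using fD w(1) T by (simp add: D.scaleR algebra_simps)
      also have "\<dots> = v" by (simp flip: w(2))
      finally show False using nv T[OF w(1)] by (metis image_eqI)
    qed
    have "inv_into (T c) f v = inv_into (T c) f (2 *\<^sub>R v)"
      unfolding inv_into_def using nv n2 by (intro arg_cong[where f=Eps] ext) (metis image_eqI)
    then have "\<alpha> *\<^sub>R v = \<alpha> *\<^sub>R (2 *\<^sub>R v)" using A[OF v] A[OF T[OF v, of 2]] by simp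
    then have "v = 2 *\<^sub>R v" using \<alpha> by simp
    then have "v = 0" by (simp add: scaleR_2)
    moreover have "f 0 = 0" using fD[of 0] by (simp add: tangent_space_def D.zero)
    ultimately show False using nv by (force simp: tangent_space_def)
  qed
  then have "f (inv_into (T c) f v) = v" by (rule f_inv_into_f)
  moreover have iv: "inv_into (T c) f v = (\<alpha> / (2 * d)) *\<^sub>R v"
  proof -
    have "inv_into (T c) f v = (1 / (2 * d)) *\<^sub>R ((2 * d) *\<^sub>R inv_into (T c) f v)"
      using d by (simp add: d_def)
    then show ?thesis unfolding A[OF v] by simp
  qed
  ultimately have "(\<alpha> / (2 * d)) *\<^sub>R (v + d *\<^sub>R D v) = v"
    using fD[OF T[OF v, of "\<alpha> / (2 * d)"]] by (simp add: D.scaleR algebra_simps)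
  then have "(2 * d / \<alpha>) *\<^sub>R ((\<alpha> / (2 * d)) *\<^sub>R (v + d *\<^sub>R D v)) = (2 * d / \<alpha>) *\<^sub>R v" by simp
  then show "v + thickness C \<Omega> c *\<^sub>R D v = (2 * thickness C \<Omega> c / \<alpha>) *\<^sub>R v"
    using d \<alpha> by (simp add: d_def)
qed

end

section \<open>The normal of the outer boundary\<close>

lemma is_inward_normal_superlevel:
  fixes g :: "'a::euclidean_space \<Rightarrow> real"
  assumes g: "(g has_derivative (\<lambda>v. n \<bullet> v)) (at x)" "n \<noteq> 0" "g x = 0" "x \<in> frontier S"
    and S: "\<forall>\<^sub>F y in at x. y \<in> S \<longleftrightarrow> g y > 0"
  shows "is_inward_normal S x (sgn n)"
  unfolding is_inward_normal_def
proof (intro conjI allI impI)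
  show "x \<in> frontier S" "norm (sgn n) = 1" using g by (auto simp: norm_sgn)
  fix \<epsilon> :: real assume \<epsilon>: "\<epsilon> > 0"
  then have "\<epsilon> * norm n > 0" using g by simp
  then obtain \<delta> where \<delta>: "\<delta> > 0"
    "\<And>y. norm (y - x) < \<delta> \<Longrightarrow> norm (g y - g x - n \<bullet> (y - x)) \<le> \<epsilon> * norm n * norm (y - x)"
    using g(1) unfolding has_derivative_at_alt by blast
  have "\<forall>\<^sub>F y in at x. norm (y - x) < \<delta>"
    unfolding eventually_at using \<delta>(1) by (auto simp: dist_norm)
  with S show "\<forall>\<^sub>F y in at x. (\<epsilon> * norm (y - x) < sgn n \<bullet> (y - x) \<longrightarrow> y \<in> S) \<and>
      (sgn n \<bullet> (y - x) < - \<epsilon> * norm (y - x) \<longrightarrow> y \<notin> S)"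
  proof eventually_elim
    case (elim y)
    have n: "n \<bullet> (y - x) = norm n * (sgn n \<bullet> (y - x))" using g(2) by (simp add: sgn_div_norm)
    have *: "\<bar>g y - n \<bullet> (y - x)\<bar> \<le> norm n * (\<epsilon> * norm (y - x))"
      using \<delta>(2)[OF elim(2)] g(3) by (simp add: mult_ac)
    have nn: "norm n > 0" using g(2) by simp
    show ?case
    proof (intro conjI impI)
      assume "\<epsilon> * norm (y - x) < sgn n \<bullet> (y - x)"
      then have "norm n * (\<epsilon> * norm (y - x)) < n \<bullet> (y - x)"
        unfolding n using nn by (rule mult_strict_left_mono)
      then show "y \<in> S" using * elim(1) by linarith
    next
      assume "sgn n \<bullet> (y - x) < - \<epsilon> * norm (y - x)"
      then have "n \<bullet> (y - x) < norm n * (- \<epsilon> * norm (y - x))"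
        unfolding n using nn by (rule mult_strict_left_mono)
      then show "y \<notin> S" using * elim(1) by (simp add: abs_le_iff)
    qed
  qed
qed

text \<open>The local data of the argument, with \<open>l\<close> standing for
  \<open>2 d(c) / \<alpha>\<close>. The first derivatives \<open>DN\<close> and \<open>G\<close> are
  given at all boundary points near \<open>c\<close>, because \<open>F p\<close> depends on the
  normal of \<open>\<Omega>\<close> over \<open>p\<close>; second-order data \<open>DG\<close> and
  isotropy enter at \<open>c\<close> only.\<close>

locale return_chart = smooth_core C for C :: "'a::euclidean_space set" +
  fixes \<Omega> :: "'a set" and c :: 'a and l r :: real and DN :: "'a \<Rightarrow> 'a \<Rightarrow> 'a"
    and G DG :: "'a \<Rightarrow> 'a"
  assumes c: "c \<in> M" and adm: "\<Omega> \<in> admissible_sets C" and fin: "finite_thickness C \<Omega>"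
    and dpos: "thickness C \<Omega> c > 0" and r: "r > 0" and l: "l > 0"
    and d\<nu>: "\<And>q. q \<in> M \<Longrightarrow> q \<in> ball c r \<Longrightarrow> (\<nu> has_derivative DN q) (at q within M)"
    and \<nu>DN: "\<And>q v. q \<in> M \<Longrightarrow> q \<in> ball c r \<Longrightarrow> \<nu> q \<bullet> DN q v = 0"
    and DN_cont: "\<And>v. ((\<lambda>q. DN q v) \<longlongrightarrow> DN c v) (at c within M)"
    and dd: "\<And>q. q \<in> M \<Longrightarrow> q \<in> ball c r \<Longrightarrow>
      (thickness C \<Omega> has_derivative (\<lambda>v. G q \<bullet> v)) (at q within M)"
    and \<nu>G: "\<And>q. q \<in> M \<Longrightarrow> q \<in> ball c r \<Longrightarrow> \<nu> q \<bullet> G q = 0"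
    and Gc: "G c = 0" and dG: "(G has_derivative DG) (at c within M)"
    and \<nu>DG: "\<And>v. \<nu> c \<bullet> DG v = 0"
    and isotropic: "\<And>v. \<nu> c \<bullet> v = 0 \<Longrightarrow> v + thickness C \<Omega> c *\<^sub>R DN c v = l *\<^sub>R v"
begin

abbreviation "d \<equiv> thickness C \<Omega>"
abbreviation "\<Phi> \<equiv> radial_map C \<Omega>"

lemma cr [simp]: "c \<in> ball c r" using r by simp

lemma \<nu>_cont: "continuous (at c within M) \<nu>"
  using d\<nu>[OF c cr] by (rule has_derivative_continuous)

lemma d_cont: "continuous (at c within M) d"
  using dd[OF c cr] by (rule has_derivative_continuous)

lemma radii_bdd: "q \<in> M \<Longrightarrow> bdd_above (insert 0 (thickness_radii C \<Omega> q))"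
  using fin by (simp add: finite_thickness_def)

lemma d_nonneg: "q \<in> M \<Longrightarrow> d q \<ge> 0"
  unfolding thickness_def using radii_bdd by (intro cSup_upper) auto

lemma \<Omega>_open: "open \<Omega>" using adm by (simp add: admissible_sets_def)

lemma radii_interval:
  assumes q: "q \<in> M" and s: "a \<in> thickness_radii C \<Omega> q" "b \<in> thickness_radii C \<Omega> q" "a \<le> s" "s \<le> b"
  shows "s \<in> thickness_radii C \<Omega> q"
proof -
  let ?R = "{q + t *\<^sub>R \<nu> q |t. t \<ge> 0} \<inter> \<Omega>"
  have "connected ?R" using adm q unfolding admissible_sets_def by blast
  then have "connected ((\<lambda>x. \<nu> q \<bullet> (x - q)) ` ?R)"
    by (intro connected_continuous_image continuous_intros)
  also have "(\<lambda>x. \<nu> q \<bullet> (x - q)) ` ?R = thickness_radii C \<Omega> q"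
    using q by (force simp: thickness_radii_def image_iff)
  finally show ?thesis using s by (meson connectedD_interval)
qed

lemma P_continuous: "continuous (at x) P"
  using continuous_on_closest_point[OF core_props(2,3,5), of UNIV]
  by (simp add: continuous_on_eq_continuous_at)

lemma P_\<Phi>: "p \<in> M \<Longrightarrow> P (\<Phi> p) = p"
  by (simp add: radial_map_def closest_point_offset d_nonneg)

lemma dist_\<Phi>: "p \<in> M \<Longrightarrow> dist (\<Phi> p) p = d p"
  by (simp add: radial_map_def dist_norm norm_outward_normal d_nonneg)

text \<open>A ray may enter \<open>\<Omega>\<close> only at a positive height \<open>s0\<close>. Since \<open>\<Omega>\<close> is open, neighbouring rays are in
  \<open>\<Omega>\<close> at that height too, so that near \<open>\<Phi> c\<close> only the upper end \<open>d\<close> matters.\<close>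

lemma region_near_\<Phi>:
  obtains \<delta> where "\<delta> > 0"
    "\<And>y. dist y (\<Phi> c) < \<delta> \<Longrightarrow> y \<notin> C"
    "\<And>y. dist y (\<Phi> c) < \<delta> \<Longrightarrow> y \<in> \<Omega> \<longleftrightarrow> dist y (P y) < d (P y)"
proof -
  have \<Phi>c: "\<Phi> c \<notin> C" using offset_notin_core[OF c dpos] by (simp add: radial_map_def)
  have "\<exists>x\<in>insert 0 (thickness_radii C \<Omega> c). 0 < x"
    using dpos less_cSup_iff[OF _ radii_bdd[OF c]] by (auto simp: thickness_def)
  then have R: "thickness_radii C \<Omega> c \<noteq> {}" by auto
  \<comment> \<open>Openness of \<open>\<Omega>\<close> puts every admissible radius strictly below
    the supremum, so that heights near \<open>d c\<close> still exceed \<open>s0\<close>.\<close>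
  have "\<exists>s0\<in>thickness_radii C \<Omega> c. s0 < d c"
  proof -
    obtain s0 where s0: "s0 \<in> thickness_radii C \<Omega> c" using R by auto
    then have "(c + s0 *\<^sub>R \<nu> c) \<in> \<Omega>" "s0 \<ge> 0" by (auto simp: thickness_radii_def)
    then obtain e where e: "e > 0" "ball (c + s0 *\<^sub>R \<nu> c) e \<subseteq> \<Omega>" using \<Omega>_open openE by blast
    have "c + (s0 + e/2) *\<^sub>R \<nu> c \<in> ball (c + s0 *\<^sub>R \<nu> c) e"
      using e c by (simp add: dist_norm algebra_simps norm_outward_normal)
    then have "s0 + e/2 \<in> thickness_radii C \<Omega> c" using e \<open>s0 \<ge> 0\<close> by (auto simp: thickness_radii_def)
    then have "s0 + e/2 \<le> d c" unfolding thickness_def using radii_bdd[OF c] by (intro cSup_upper) auto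
    then show ?thesis using s0 e by (intro bexI[of _ s0]) auto
  qed
  then obtain s0 where s0: "s0 \<in> thickness_radii C \<Omega> c" "s0 < d c" by blast
  have "c + s0 *\<^sub>R \<nu> c \<in> \<Omega>" using s0 by (simp add: thickness_radii_def)
  then obtain e where e: "e > 0" "ball (c + s0 *\<^sub>R \<nu> c) e \<subseteq> \<Omega>" using \<Omega>_open openE by blast
  have "continuous (at c within M) (\<lambda>q. q + s0 *\<^sub>R \<nu> q)" using \<nu>_cont by (intro continuous_intros)
  then obtain \<delta>1 where \<delta>1: "\<delta>1 > 0"
      "\<And>q. q \<in> M \<Longrightarrow> dist q c < \<delta>1 \<Longrightarrow> dist (q + s0 *\<^sub>R \<nu> q) (c + s0 *\<^sub>R \<nu> c) < e"
    using e(1) unfolding continuous_within_eps_delta by metis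
  have s0R: "s0 \<in> thickness_radii C \<Omega> q" if "q \<in> M" "dist q c < \<delta>1" for q
    using \<delta>1(2)[OF that] e(2) s0(1) by (auto simp: thickness_radii_def dist_commute)
  obtain \<delta>2 where \<delta>2: "\<delta>2 > 0" "\<And>y. dist y (\<Phi> c) < \<delta>2 \<Longrightarrow> dist (P y) c < \<delta>1"
    using P_continuous[of "\<Phi> c"] \<delta>1(1) unfolding continuous_at_eps_delta P_\<Phi>[OF c] by metis
  have "continuous (at (\<Phi> c)) (\<lambda>y. dist y (P y))" using P_continuous by (intro continuous_intros)
  then obtain \<delta>3 where \<delta>3: "\<delta>3 > 0" "\<And>y. dist y (\<Phi> c) < \<delta>3 \<Longrightarrow> dist (dist y (P y)) (d c) < d c - s0"
    using s0(2) unfolding continuous_at_eps_delta P_\<Phi>[OF c] dist_\<Phi>[OF c] by (metis diff_gt_0_iff_gt)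
  obtain \<delta>4 where \<delta>4: "\<delta>4 > 0" "\<And>y. dist y (\<Phi> c) < \<delta>4 \<Longrightarrow> y \<notin> C"
  proof -
    have "open (- C)" using core_props by auto
    then obtain \<delta> where "\<delta> > 0" "ball (\<Phi> c) \<delta> \<subseteq> - C" using \<Phi>c by (metis ComplI openE)
    then show ?thesis by (intro that[of \<delta>]) (auto simp: dist_commute)
  qed
  show ?thesis
  proof (rule that[of "min \<delta>2 (min \<delta>3 \<delta>4)"])
    show "min \<delta>2 (min \<delta>3 \<delta>4) > 0" using \<delta>2 \<delta>3 \<delta>4 by simp
    fix y assume y: "dist y (\<Phi> c) < min \<delta>2 (min \<delta>3 \<delta>4)"
    then show nC: "y \<notin> C" using \<delta>4 by simp
    define q s where "q = P y" and "s = dist y (P y)"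
    have q: "q \<in> M" "y = q + s *\<^sub>R \<nu> q" "dist q c < \<delta>1" and s: "s > s0" "s \<ge> 0"
      using closest_point_frontier[OF nC] \<delta>2(2)[of y] \<delta>3(2)[of y] y
      by (auto simp: q_def s_def dist_real_def)
    have "y \<in> \<Omega> \<longleftrightarrow> s < d q"
    proof
      assume "y \<in> \<Omega>"
      then obtain e where e: "e > 0" "ball y e \<subseteq> \<Omega>" using \<Omega>_open openE by blast
      have "q + (s + e/2) *\<^sub>R \<nu> q \<in> ball y e"
        using e q(1) by (subst q(2)) (simp add: dist_norm algebra_simps norm_outward_normal)
      then have "s + e/2 \<in> thickness_radii C \<Omega> q" using e s by (auto simp: thickness_radii_def)
      then have "s + e/2 \<le> d q" unfolding thickness_def using radii_bdd[OF q(1)]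
        by (intro cSup_upper) auto
      then show "s < d q" using e by simp
    next
      assume "s < d q"
      then obtain b where b: "b \<in> insert 0 (thickness_radii C \<Omega> q)" "s < b"
        unfolding thickness_def using less_cSup_iff[OF _ radii_bdd[OF q(1)]] by auto
      then have "s \<in> thickness_radii C \<Omega> q"
        by (intro radii_interval[OF q(1) s0R[OF q(1,3)], of b s]) (use s in auto)
      then show "y \<in> \<Omega>" by (subst q(2)) (simp add: thickness_radii_def)
    qed
    then show "y \<in> \<Omega> \<longleftrightarrow> dist y (P y) < d (P y)" by (simp add: q_def s_def)
  qed
qed

text \<open>Differentiability of \<open>P\<close> is avoided: with
  \<open>y = q + s *\<^sub>R \<nu> q\<close> the remainder is exactly
  \<open>- (K q + (s - d p) * (n \<bullet> (\<nu> q - \<nu> p)))\<close>. Both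
  \<open>norm (q - p)\<close> and \<open>\<bar>s - d p\<bar>\<close> are at most
  \<open>norm (y - x)\<close>, and the second term has the additional small factor
  \<open>\<nu> q - \<nu> p\<close>.\<close>

lemma thickness_defect_derivative:
  assumes p: "p \<in> M" "p \<in> ball c r" and \<Phi>p: "\<Phi> p \<notin> C"
    and w: "\<nu> p \<bullet> w = 0" "\<And>\<theta>. \<nu> p \<bullet> \<theta> = 0 \<Longrightarrow> w \<bullet> (\<theta> + d p *\<^sub>R DN p \<theta>) = G p \<bullet> \<theta>"
  shows "((\<lambda>y. d (P y) - dist y (P y)) has_derivative (\<lambda>v. (w - \<nu> p) \<bullet> v)) (at (\<Phi> p))"
proof -
  define n where "n = w - \<nu> p"
  define x where "x = \<Phi> p"
  have "w \<bullet> \<nu> p = 0" using w(1) by (simp add: inner_commute)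
  then have n\<nu>: "n \<bullet> \<nu> p = -1" using p by (simp add: n_def inner_diff_left)
  \<comment> \<open>The equation for \<open>w\<close> says precisely that the derivative of
    \<open>K\<close> at \<open>p\<close> vanishes on tangent vectors.\<close>
  define K where "K q = n \<bullet> (q - p) + (d p - d q) + d p * (n \<bullet> (\<nu> q - \<nu> p))" for q
  interpret DNp: bounded_linear "DN p" using d\<nu>[OF p] by (rule has_derivative_bounded_linear)
  have "(K has_derivative (\<lambda>v. n \<bullet> v - G p \<bullet> v + d p * (n \<bullet> DN p v))) (at p within M)"
    unfolding K_def by (auto intro!: derivative_eq_intros dd[OF p] d\<nu>[OF p])
  then have "(K has_derivative (\<lambda>_. 0)) (at p within M)"
    by (rule has_derivative_tangent_cong[OF hypersurface_normal_outward[OF p(1)] _ bounded_linear_zero])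
       (use w(2) \<nu>DN[OF p] in \<open>auto simp: n_def inner_diff_left inner_add_right algebra_simps\<close>)
  then have K: "\<exists>\<delta>>0. \<forall>q\<in>M. norm (q - p) < \<delta> \<longrightarrow> \<bar>K q\<bar> \<le> e * norm (q - p)" if "e > 0" for e
    using that unfolding has_derivative_within_alt by (auto simp: K_def)
  have \<nu>p: "continuous (at p within M) \<nu>" using d\<nu>[OF p] by (rule has_derivative_continuous)
  have "\<exists>\<delta>>0. \<forall>y. norm (y - x) < \<delta> \<longrightarrow>
      norm (d (P y) - dist y (P y) - (d (P x) - dist x (P x)) - n \<bullet> (y - x)) \<le> e * norm (y - x)"
    if e: "e > 0" for e
  proof -
    obtain \<delta>1 where \<delta>1: "\<delta>1 > 0" "\<And>q. q \<in> M \<Longrightarrow> norm (q - p) < \<delta>1 \<Longrightarrow> \<bar>K q\<bar> \<le> e/2 * norm (q - p)"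
      using K[of "e/2"] e by auto
    define \<eta> where "\<eta> = e / (2 * (norm n + 1))"
    have \<eta>: "\<eta> > 0" "norm n * \<eta> \<le> e/2" using e
      by (auto simp: \<eta>_def field_simps add_pos_nonneg intro!: mult_left_mono)
    obtain \<delta>2 where \<delta>2: "\<delta>2 > 0" "\<And>q. q \<in> M \<Longrightarrow> dist q p < \<delta>2 \<Longrightarrow> dist (\<nu> q) (\<nu> p) < \<eta>"
      using \<nu>p \<eta>(1) unfolding continuous_within_eps_delta by metis
    obtain \<delta>3 where \<delta>3: "\<delta>3 > 0" "ball x \<delta>3 \<subseteq> - C"
      using \<Phi>p core_props(3) unfolding x_def by (metis ComplI openE open_Compl)
    have main: "norm (d (P y) - dist y (P y) - (d (P x) - dist x (P x)) - n \<bullet> (y - x)) \<le> e * norm (y - x)"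
      if y: "norm (y - x) < min \<delta>1 (min \<delta>2 \<delta>3)" for y
    proof -
      have nC: "y \<notin> C" using y \<delta>3 by (auto simp: dist_norm norm_minus_commute subset_iff)
      define q s where "q = P y" and "s = dist y (P y)"
      have q: "q \<in> M" "y = q + s *\<^sub>R \<nu> q"
        using closest_point_frontier[OF nC] by (auto simp: q_def s_def)
      have Px: "P x = p" "dist x p = d p" using P_\<Phi> dist_\<Phi> p by (auto simp: x_def)
      have qp: "norm (q - p) \<le> norm (y - x)"
        using closest_point_lipschitz[OF core_props(2,3,5), of y x] Px by (simp add: q_def dist_norm)
      have "\<bar>dist y q - dist x p\<bar> = \<bar>setdist {y} C - setdist {x} C\<bar>"
        using Px core_props by (simp add: setdist_closest_point q_def)
      also have "\<dots> \<le> dist y x" by (rule setdist_Lipschitz)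
      finally have sd: "\<bar>s - d p\<bar> \<le> norm (y - x)" using Px by (simp add: s_def q_def dist_norm)
      have xe: "x = p + d p *\<^sub>R \<nu> p" by (simp add: x_def radial_map_def)
      have "d q - s - n \<bullet> (y - x) = - (K q + (s - d p) * (n \<bullet> (\<nu> q - \<nu> p)))"
        unfolding q(2) xe K_def by (simp add: inner_diff_right inner_add_right n\<nu> algebra_simps)
      then have "\<bar>d q - s - n \<bullet> (y - x)\<bar> \<le> \<bar>K q\<bar> + \<bar>s - d p\<bar> * \<bar>n \<bullet> (\<nu> q - \<nu> p)\<bar>"
        by (simp add: abs_mult[symmetric])
      also have "\<dots> \<le> e/2 * norm (y - x) + norm (y - x) * (e/2)"
      proof (rule add_mono)
        have "\<bar>K q\<bar> \<le> e/2 * norm (q - p)" using \<delta>1(2)[OF q(1)] qp y by simp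
        also have "\<dots> \<le> e/2 * norm (y - x)" using qp e by (intro mult_left_mono) auto
        finally show "\<bar>K q\<bar> \<le> e/2 * norm (y - x)" .
        have "\<bar>n \<bullet> (\<nu> q - \<nu> p)\<bar> \<le> norm n * norm (\<nu> q - \<nu> p)" by (rule Cauchy_Schwarz_ineq2)
        also have "\<dots> \<le> norm n * \<eta>"
          using \<delta>2(2)[OF q(1)] qp y by (intro mult_left_mono) (auto simp: dist_norm)
        also note \<eta>(2)
        finally show "\<bar>s - d p\<bar> * \<bar>n \<bullet> (\<nu> q - \<nu> p)\<bar> \<le> norm (y - x) * (e/2)"
          using sd by (intro mult_mono) auto
      qed
      finally have "\<bar>d q - s - n \<bullet> (y - x)\<bar> \<le> e * norm (y - x)" by (simp add: mult.commute)
      then show ?thesis using Px by (simp add: q_def[symmetric] s_def)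
    qed
    show ?thesis
      by (rule exI[of _ "min \<delta>1 (min \<delta>2 \<delta>3)"]) (use main \<delta>1(1) \<delta>2(1) \<delta>3(1) in auto)
  qed
  then show ?thesis unfolding has_derivative_at_alt n_def[symmetric] x_def[symmetric]
    by (auto intro: bounded_linear_inner_right)
qed

text \<open>The description of \<open>\<Omega>\<close> by the defect
  \<open>d (P y) - dist y (P y)\<close> holds on an open ball around \<open>\<Phi> c\<close>, hence
  near \<open>\<Phi> p\<close> for all \<open>p\<close> close to \<open>c\<close>, with one
  \<open>\<delta>\<close> for every \<open>w\<close>.\<close>

lemma inward_normal_\<Phi>:
  obtains \<delta> where "\<delta> > 0"
    "\<And>p w. p \<in> M \<Longrightarrow> dist p c < \<delta> \<Longrightarrow> \<nu> p \<bullet> w = 0 \<Longrightarrow>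
      (\<And>\<theta>. \<nu> p \<bullet> \<theta> = 0 \<Longrightarrow> w \<bullet> (\<theta> + d p *\<^sub>R DN p \<theta>) = G p \<bullet> \<theta>) \<Longrightarrow>
      inward_normal \<Omega> (\<Phi> p) = sgn (w - \<nu> p)"
proof -
  obtain \<delta>0 where \<delta>0: "\<delta>0 > 0" "\<And>y. dist y (\<Phi> c) < \<delta>0 \<Longrightarrow> y \<notin> C"
    "\<And>y. dist y (\<Phi> c) < \<delta>0 \<Longrightarrow> y \<in> \<Omega> \<longleftrightarrow> dist y (P y) < d (P y)"
    using region_near_\<Phi> by metis
  have "continuous (at c within M) \<Phi>" unfolding radial_map_def[abs_def]
    by (intro continuous_intros \<nu>_cont d_cont)
  then obtain \<delta>1 where \<delta>1: "\<delta>1 > 0" "\<And>p. p \<in> M \<Longrightarrow> dist p c < \<delta>1 \<Longrightarrow> dist (\<Phi> p) (\<Phi> c) < \<delta>0"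
    using \<delta>0(1) unfolding continuous_within_eps_delta by metis
  show ?thesis
  proof (rule that[of "min \<delta>1 r"])
    show "min \<delta>1 r > 0" using \<delta>1 r by simp
    fix p w assume p: "p \<in> M" "dist p c < min \<delta>1 r" and w: "\<nu> p \<bullet> w = 0"
      "\<And>\<theta>. \<nu> p \<bullet> \<theta> = 0 \<Longrightarrow> w \<bullet> (\<theta> + d p *\<^sub>R DN p \<theta>) = G p \<bullet> \<theta>"
    have pr: "p \<in> ball c r" using p by (simp add: dist_commute)
    have near: "dist (\<Phi> p) (\<Phi> c) < \<delta>0" using \<delta>1 p by simp
    then have nC: "\<Phi> p \<notin> C" using \<delta>0 by simp
    have dp: "d p > 0"
    proof (rule ccontr)
      assume "\<not> d p > 0"
      then have "\<Phi> p = p" using d_nonneg[OF p(1)] by (simp add: radial_map_def)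
      then show False using nC p(1) core_props(6) by auto
    qed
    define e0 where "e0 = \<delta>0 - dist (\<Phi> p) (\<Phi> c)"
    have e0: "e0 > 0" using near by (simp add: e0_def)
    have close: "dist y (\<Phi> c) < \<delta>0" if "dist y (\<Phi> p) < e0" for y
      using that dist_triangle[of y "\<Phi> c" "\<Phi> p"] by (simp add: e0_def)
    have g0: "d (P (\<Phi> p)) - dist (\<Phi> p) (P (\<Phi> p)) = 0" using P_\<Phi>[OF p(1)] dist_\<Phi>[OF p(1)] by simp
    have notin: "\<Phi> p \<notin> \<Omega>" using \<delta>0(3)[OF near] g0 by simp
    have "\<Phi> p \<in> closure \<Omega>" unfolding closure_approachable
    proof (intro allI impI)
      fix e :: real assume e: "e > 0"
      \<comment> \<open>A point just below \<open>\<Phi> p\<close> on its own ray: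
        \<open>h < e0\<close> keeps it in the described region, \<open>h < d p\<close> keeps its
        height positive, so that it projects to \<open>p\<close>.\<close>
      define h where "h = min e (min e0 (d p)) / 2"
      have h: "0 < h" "h < e" "h < e0" "h < d p" using e e0 dp by (auto simp: h_def)
      define y where "y = p + (d p - h) *\<^sub>R \<nu> p"
      have yd: "dist y (\<Phi> p) = h"
        using h(1) p by (simp add: y_def radial_map_def dist_norm algebra_simps norm_outward_normal)
      have Py: "P y = p" unfolding y_def using h by (intro closest_point_offset p) auto
      have "dist y p = d p - h" using h p by (simp add: y_def dist_norm norm_outward_normal)
      then have "y \<in> \<Omega>" using \<delta>0(3)[OF close] yd h Py by simp
      then show "\<exists>y\<in>\<Omega>. dist y (\<Phi> p) < e" using yd h by auto
    qed
    then have fr: "\<Phi> p \<in> frontier \<Omega>" using notin \<Omega>_open by (simp add: frontier_def interior_open)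
    have "\<nu> p \<bullet> (w - \<nu> p) \<noteq> 0" using w(1) p by (simp add: inner_diff_right)
    then have n0: "w - \<nu> p \<noteq> 0" by auto
    have "\<forall>\<^sub>F y in at (\<Phi> p). y \<in> \<Omega> \<longleftrightarrow> 0 < d (P y) - dist y (P y)"
      unfolding eventually_at using \<delta>0(3)[OF close] e0 by auto
    from is_inward_normal_superlevel[OF thickness_defect_derivative[OF p(1) pr nC w] n0 g0 fr this]
    show "inward_normal \<Omega> (\<Phi> p) = sgn (w - \<nu> p)" by (rule inward_normal_eqI)
  qed
qed

end

section \<open>First-order expansion of the normal\<close>

lemma linear_eq_sum_Basis:
  fixes A :: "'a::euclidean_space \<Rightarrow> 'b::real_vector"
  assumes "linear A"
  shows "A v = (\<Sum>b\<in>Basis. (v \<bullet> b) *\<^sub>R A b)"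
proof -
  have "A v = A (\<Sum>b\<in>Basis. (v \<bullet> b) *\<^sub>R b)" by (simp add: euclidean_representation)
  also have "\<dots> = (\<Sum>b\<in>Basis. (v \<bullet> b) *\<^sub>R A b)"
    using assms by (simp add: linear_sum linear_scale)
  finally show ?thesis .
qed

lemma tendsto_linear_apply:
  fixes A :: "'x \<Rightarrow> 'a::euclidean_space \<Rightarrow> 'b::real_normed_vector"
  assumes lin: "\<forall>\<^sub>F p in F. linear (A p)" "linear B"
    and A: "\<And>v. ((\<lambda>p. A p v) \<longlongrightarrow> B v) F" and u: "(u \<longlongrightarrow> u0) F"
  shows "((\<lambda>p. A p (u p)) \<longlongrightarrow> B u0) F"
proof (rule Lim_transform_eventually)
  show "((\<lambda>p. \<Sum>b\<in>Basis. (u p \<bullet> b) *\<^sub>R A p b) \<longlongrightarrow> B u0) F"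
    unfolding linear_eq_sum_Basis[OF lin(2), of u0] by (intro tendsto_intros A u)
  show "\<forall>\<^sub>F p in F. (\<Sum>b\<in>Basis. (u p \<bullet> b) *\<^sub>R A p b) = A p (u p)"
    using lin(1) by eventually_elim (simp flip: linear_eq_sum_Basis)
qed

text \<open>Convergence on the finitely many basis vectors controls the operator norm, so pointwise
  convergence of linear maps is uniform in the direction.\<close>

lemma eventually_linear_close:
  fixes A :: "'x \<Rightarrow> 'a::euclidean_space \<Rightarrow> 'b::real_normed_vector"
  assumes lin: "\<forall>\<^sub>F p in F. linear (A p)" "linear B"
    and A: "\<And>v. ((\<lambda>p. A p v) \<longlongrightarrow> B v) F" and e: "e > 0"
  shows "\<forall>\<^sub>F p in F. \<forall>v. norm (A p v - B v) \<le> e * norm v"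
proof -
  have "((\<lambda>p. \<Sum>b\<in>Basis. norm (A p b - B b)) \<longlongrightarrow> (\<Sum>b\<in>(Basis::'a set). norm (B b - B b))) F"
    by (intro tendsto_intros A)
  then have "\<forall>\<^sub>F p in F. (\<Sum>b\<in>Basis. norm (A p b - B b)) < e"
    using e by (intro order_tendstoD) auto
  with lin(1) show ?thesis
  proof eventually_elim
    case (elim p)
    show ?case
    proof
      fix v :: 'a
      have "A p v - B v = (\<Sum>b\<in>Basis. (v \<bullet> b) *\<^sub>R (A p b - B b))"
        unfolding linear_eq_sum_Basis[OF elim(1), of v] linear_eq_sum_Basis[OF lin(2), of v]
        by (simp add: sum_subtractf scaleR_diff_right)
      also have "norm \<dots> \<le> (\<Sum>b\<in>Basis. norm ((v \<bullet> b) *\<^sub>R (A p b - B b)))" by (rule norm_sum)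
      also have "\<dots> \<le> (\<Sum>b\<in>Basis. norm v * norm (A p b - B b))"
        by (intro sum_mono) (auto intro!: mult_right_mono simp: Basis_le_norm)
      also have "\<dots> = (\<Sum>b\<in>Basis. norm (A p b - B b)) * norm v"
        by (simp add: sum_distrib_left mult.commute)
      also have "\<dots> \<le> e * norm v" using elim by (intro mult_right_mono) auto
      finally show "norm (A p v - B v) \<le> e * norm v" .
    qed
  qed
qed

text \<open>The adjoint has the same quadratic form as \<open>A\<close>, so it is injective, hence
  onto. Testing the equation with \<open>w\<close> itself gives the norm bound.\<close>

lemma coercive_transpose_solvable:
  fixes A :: "'a::euclidean_space \<Rightarrow> 'a"
  assumes lin: "linear A" and m: "m > 0" and coer: "\<And>v. m * (norm v)\<^sup>2 \<le> v \<bullet> A v"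
  obtains w where "\<And>v. w \<bullet> A v = b \<bullet> v" "norm w \<le> norm b / m"
proof -
  have adj: "x \<bullet> adjoint A y = A x \<bullet> y" for x y using adjoint_works[OF lin] .
  have "inj (adjoint A)"
  proof (rule linear_injective_0[OF adjoint_linear[OF lin], THEN iffD2], intro allI impI)
    fix v assume "adjoint A v = 0"
    then have "v \<bullet> A v = 0" using adj[of v v] by (simp add: inner_commute)
    then have "m * (norm v)\<^sup>2 \<le> 0" using coer[of v] by simp
    then show "v = 0" using m by (auto simp: mult_le_0_iff)
  qed
  then have "surj (adjoint A)"
    using linear_injective_imp_surjective[OF adjoint_linear[OF lin]] by simp
  then obtain w where w: "adjoint A w = b" by (metis surjD)
  have wA: "w \<bullet> A v = b \<bullet> v" for v using adj[of v w] w by (simp add: inner_commute)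
  have "m * (norm w)\<^sup>2 \<le> norm b * norm w"
    using coer[of w] wA[of w] norm_cauchy_schwarz[of b w] by simp
  then have "norm w * (m * norm w) \<le> norm w * norm b" by (simp add: power2_eq_square mult_ac)
  then have "m * norm w \<le> norm b" by (cases "w = 0") (auto simp: mult_le_cancel_left)
  then show ?thesis using m by (intro that[of w] wA) (simp add: field_simps)
qed

section \<open>The tilt \<open>w\<close> of the outer normal near the critical point\<close>

context return_chart
begin

lemma eventually_in_chart: "\<forall>\<^sub>F p in at c within M. p \<in> M \<and> p \<in> ball c r"
  unfolding eventually_at using r by (intro exI[of _ r]) (auto simp: dist_commute)

lemma DN_linear: "p \<in> M \<Longrightarrow> p \<in> ball c r \<Longrightarrow> linear (DN p)"
  using d\<nu> has_derivative_linear by blast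

text \<open>\<open>I + d D\<nu>\<close> on the tangent space at \<open>p\<close>, continued by the
  identity along \<open>\<nu> p\<close>. The tangent spaces vary with \<open>p\<close>; the extended
  operators act on one space and can be compared.\<close>

definition L :: "'a \<Rightarrow> 'a \<Rightarrow> 'a" where
  "L p v = v + d p *\<^sub>R DN p (v - (\<nu> p \<bullet> v) *\<^sub>R \<nu> p)"

lemma L_linear:
  assumes "p \<in> M" "p \<in> ball c r"
  shows "linear (L p)"
proof -
  interpret linear "DN p" by (rule DN_linear[OF assms])
  show ?thesis unfolding L_def
    by (rule linearI) (simp_all add: add diff scale algebra_simps)
qed

lemma L_tendsto: "((\<lambda>p. L p v) \<longlongrightarrow> L c v) (at c within M)"
proof -
  have \<nu>: "(\<nu> \<longlongrightarrow> \<nu> c) (at c within M)" and d: "(d \<longlongrightarrow> d c) (at c within M)"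
    using \<nu>_cont d_cont by (auto simp: continuous_within)
  have "((\<lambda>p. DN p (v - (\<nu> p \<bullet> v) *\<^sub>R \<nu> p)) \<longlongrightarrow> DN c (v - (\<nu> c \<bullet> v) *\<^sub>R \<nu> c)) (at c within M)"
  proof (rule tendsto_linear_apply[OF _ DN_linear[OF c cr] DN_cont])
    show "\<forall>\<^sub>F p in at c within M. linear (DN p)"
      by (rule eventually_mono[OF eventually_in_chart]) (use DN_linear in auto)
  qed (intro tendsto_intros \<nu>)
  then show ?thesis unfolding L_def by (intro tendsto_intros d)
qed

lemma L_c: "L c v = l *\<^sub>R (v - (\<nu> c \<bullet> v) *\<^sub>R \<nu> c) + (\<nu> c \<bullet> v) *\<^sub>R \<nu> c"
proof -
  define u where "u = v - (\<nu> c \<bullet> v) *\<^sub>R \<nu> c"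
  have "\<nu> c \<bullet> u = 0" using c by (simp add: u_def inner_diff_right)
  from isotropic[OF this] have "d c *\<^sub>R DN c u = l *\<^sub>R u - u" by (simp add: algebra_simps)
  then show ?thesis unfolding L_def u_def[symmetric] by (simp add: u_def)
qed

lemma L_c_coercive: "min l 1 * (norm v)\<^sup>2 \<le> v \<bullet> L c v"
proof -
  have "v \<bullet> L c v = l * ((norm v)\<^sup>2 - (\<nu> c \<bullet> v)\<^sup>2) + (\<nu> c \<bullet> v)\<^sup>2"
    unfolding L_c by (simp add: inner_add_right inner_diff_right dot_square_norm
        power2_eq_square inner_commute)
  moreover have "(\<nu> c \<bullet> v)\<^sup>2 \<le> (norm v)\<^sup>2"
    using Cauchy_Schwarz_ineq2[of "\<nu> c" v] c
    by (intro abs_le_square_iff[THEN iffD1]) (simp add: norm_outward_normal)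
  then have "min l 1 * ((norm v)\<^sup>2 - (\<nu> c \<bullet> v)\<^sup>2) \<le> l * ((norm v)\<^sup>2 - (\<nu> c \<bullet> v)\<^sup>2)"
    by (intro mult_right_mono) auto
  moreover have "min l 1 * (\<nu> c \<bullet> v)\<^sup>2 \<le> 1 * (\<nu> c \<bullet> v)\<^sup>2" by (intro mult_right_mono) auto
  ultimately show ?thesis by (simp add: algebra_simps)
qed

text \<open>At \<open>c\<close> the operator \<open>L c\<close> is coercive and \<open>DG (p - c) /\<^sub>R l\<close> solves the transposed equation with
  right-hand side \<open>DG (p - c)\<close>; nearby, \<open>L p\<close> and \<open>G p\<close> are small perturbations of these data.\<close>

lemma tilt_expansion:
  assumes \<epsilon>: "\<epsilon> > 0"
  shows "\<exists>\<delta>>0. \<forall>p\<in>M. dist p c < \<delta> \<longrightarrow> (\<exists>w. \<nu> p \<bullet> w = 0 \<and>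
    (\<forall>\<theta>. \<nu> p \<bullet> \<theta> = 0 \<longrightarrow> w \<bullet> (\<theta> + d p *\<^sub>R DN p \<theta>) = G p \<bullet> \<theta>) \<and>
    norm (w - DG (p - c) /\<^sub>R l) \<le> \<epsilon> * norm (p - c))"
proof -
  define m where "m = min l 1"
  have m: "m > 0" using l by (simp add: m_def)
  interpret DG: bounded_linear DG using dG by (rule has_derivative_bounded_linear)
  obtain K where K: "K > 0" "\<And>v. norm (DG v) \<le> norm v * K" using DG.pos_bounded by blast
  \<comment> \<open>The 1 accounts for the error of \<open>G p\<close> against
    \<open>DG (p - c)\<close>; the other term is the bound on \<open>norm w\<close> per unit of
    \<open>norm (p - c)\<close>, multiplied later by the error of \<open>L p\<close> against
    \<open>L c\<close>.\<close>
  define B where "B = 1 + 2 / m * (K + 1)"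
  have B: "B > 0" using m K by (simp add: B_def add_pos_pos)
  define e where "e = min 1 (min (m / 2) (\<epsilon> * m / B))"
  have e: "e > 0" "e \<le> 1" using m \<epsilon> B by (simp_all add: e_def)
  have e3: "e \<le> m / 2" unfolding e_def by (intro min.coboundedI2 min.cobounded1)
  have "e \<le> \<epsilon> * m / B" by (simp add: e_def)
  then have e4: "e * B \<le> \<epsilon> * m" using B by (simp add: pos_le_divide_eq)
  have "\<forall>\<^sub>F p in at c within M. linear (L p)"
    by (rule eventually_mono[OF eventually_in_chart]) (use L_linear in auto)
  from eventually_linear_close[OF this L_linear[OF c cr] L_tendsto e(1)]
  have "\<forall>\<^sub>F p in at c within M. \<forall>v. norm (L p v - L c v) \<le> e * norm v" .
  then obtain \<delta>1 where \<delta>1: "\<delta>1 > 0"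
    "\<And>p v. p \<in> M \<Longrightarrow> p \<noteq> c \<Longrightarrow> dist p c < \<delta>1 \<Longrightarrow> norm (L p v - L c v) \<le> e * norm v"
    unfolding eventually_at by metis
  obtain \<delta>2 where \<delta>2: "\<delta>2 > 0"
    "\<And>p. p \<in> M \<Longrightarrow> norm (p - c) < \<delta>2 \<Longrightarrow> norm (G p - DG (p - c)) \<le> e * norm (p - c)"
    using dG e(1) Gc unfolding has_derivative_within_alt by (metis diff_zero)
  show ?thesis
  proof (intro exI[of _ "min r (min \<delta>1 \<delta>2)"] conjI ballI impI)
    show "min r (min \<delta>1 \<delta>2) > 0" using r \<delta>1 \<delta>2 by simp
    fix p assume p: "p \<in> M" "dist p c < min r (min \<delta>1 \<delta>2)"
    have pr: "p \<in> ball c r" using p by (simp add: dist_commute)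
    have close: "norm (L p v - L c v) \<le> e * norm v" for v
      using \<delta>1(2)[OF p(1), of v] p e(1) by (cases "p = c") auto
    have coer: "m / 2 * (norm v)\<^sup>2 \<le> v \<bullet> L p v" for v
    proof -
      have "\<bar>v \<bullet> (L p v - L c v)\<bar> \<le> norm v * norm (L p v - L c v)" by (rule Cauchy_Schwarz_ineq2)
      also have "\<dots> \<le> norm v * (m / 2 * norm v)"
        using close[of v] e3 by (intro mult_left_mono order_trans[OF close] mult_right_mono) auto
      finally have "\<bar>v \<bullet> (L p v - L c v)\<bar> \<le> m / 2 * (norm v)\<^sup>2" by (simp add: power2_eq_square mult_ac)
      moreover have "m * (norm v)\<^sup>2 \<le> v \<bullet> L c v" using L_c_coercive by (simp add: m_def)
      ultimately show ?thesis unfolding inner_diff_right by linarith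
    qed
    obtain w where w: "\<And>v. w \<bullet> L p v = G p \<bullet> v" "norm w \<le> norm (G p) / (m / 2)"
      using coercive_transpose_solvable[OF L_linear[OF p(1) pr] _ coer] m by (metis half_gt_zero)
    \<comment> \<open>\<open>L p\<close> fixes the normal, so the equation tested at
      \<open>\<nu> p\<close> forces \<open>w\<close> to be tangent.\<close>
    have "L p (\<nu> p) = \<nu> p" using p DN_linear[OF p(1) pr] by (simp add: L_def linear_0)
    then have \<nu>w: "\<nu> p \<bullet> w = 0" using w(1)[of "\<nu> p"] \<nu>G[OF p(1) pr] by (simp add: inner_commute)
    have eq: "w \<bullet> (\<theta> + d p *\<^sub>R DN p \<theta>) = G p \<bullet> \<theta>" if "\<nu> p \<bullet> \<theta> = 0" for \<theta>
      using w(1)[of \<theta>] that by (simp add: L_def)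
    define h where "h = norm (p - c)"
    have GDG: "norm (G p - DG (p - c)) \<le> e * h" using \<delta>2(2)[OF p(1)] p by (simp add: dist_norm h_def)
    have "norm (G p) \<le> norm (G p - DG (p - c)) + norm (DG (p - c))"
      using norm_triangle_ineq[of "G p - DG (p - c)" "DG (p - c)"] by simp
    also have "\<dots> \<le> 1 * h + K * h"
      using GDG e K(2)[of "p - c"] by (intro add_mono order_trans[OF GDG] mult_right_mono)
        (auto simp: h_def mult.commute)
    finally have Gp: "norm (G p) \<le> (K + 1) * h" by (simp add: algebra_simps)
    have nw: "norm w \<le> 2 / m * (K + 1) * h"
    proof -
      have "norm w \<le> 2 / m * norm (G p)" using w(2) by (simp add: mult.commute)
      also have "\<dots> \<le> 2 / m * ((K + 1) * h)" using Gp m by (intro mult_left_mono) auto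
      finally show ?thesis by (simp only: mult.assoc)
    qed
    define z where "z = DG (p - c) /\<^sub>R l"
    have z: "z \<bullet> L c v = DG (p - c) \<bullet> v" for v
      using l \<nu>DG[of "p - c"] unfolding L_c z_def
      by (simp add: inner_add_right inner_diff_right inner_commute)
    define v where "v = w - z"
    have "m * (norm v)\<^sup>2 \<le> v \<bullet> L c v" using L_c_coercive by (simp add: m_def)
    \<comment> \<open>The equations for \<open>w\<close> and \<open>z\<close> are subtracted; the
      mismatch of the operators is applied to \<open>v\<close> and paired with \<open>w\<close>,
      which is itself of order \<open>norm (p - c)\<close>.\<close>
    also have "v \<bullet> L c v = (G p - DG (p - c)) \<bullet> v + w \<bullet> (L c v - L p v)"
      unfolding inner_diff_right w(1) inner_diff_left z[symmetric] by (simp add: v_def inner_diff_left)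
    also have "\<dots> \<le> norm (G p - DG (p - c)) * norm v + norm w * norm (L p v - L c v)"
      using norm_cauchy_schwarz[of "G p - DG (p - c)" v] norm_cauchy_schwarz[of w "L c v - L p v"]
      by (simp add: norm_minus_commute)
    also have "\<dots> \<le> (e * h) * norm v + (2 / m * (K + 1) * h) * (e * norm v)"
      using GDG nw close[of v] K m e(1) by (intro add_mono mult_mono) (auto simp: h_def)
    also have "\<dots> = (e * B) * (h * norm v)" by (simp add: B_def algebra_simps)
    also have "\<dots> \<le> (\<epsilon> * m) * (h * norm v)" using e4 by (intro mult_right_mono) (auto simp: h_def)
    finally have "(m * norm v) * norm v \<le> (m * norm v) * (\<epsilon> * h) "
      by (simp add: power2_eq_square mult_ac)
    then have "norm v \<le> \<epsilon> * h" using m \<epsilon> by (cases "v = 0") (auto simp: h_def)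
    then show "\<exists>w. \<nu> p \<bullet> w = 0 \<and>
        (\<forall>\<theta>. \<nu> p \<bullet> \<theta> = 0 \<longrightarrow> w \<bullet> (\<theta> + d p *\<^sub>R DN p \<theta>) = G p \<bullet> \<theta>) \<and>
        norm (w - DG (p - c) /\<^sub>R l) \<le> \<epsilon> * norm (p - c)"
      using \<nu>w eq by (intro exI[of _ w]) (auto simp: v_def z_def h_def)
  qed
qed

end

section \<open>The differential of the return map\<close>

text \<open>On the reals \<open>LEAST\<close> is meaningful only when a minimum is attained, which
  closedness and the lower bound guarantee.\<close>

lemma Least_real_closed:
  fixes A :: "real set"
  assumes "closed A" "a \<in> A" "\<And>x. x \<in> A \<Longrightarrow> b \<le> x"
  shows "(LEAST x. x \<in> A) \<in> A" "(LEAST x. x \<in> A) \<le> a"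
proof -
  have bdd: "bdd_below A" using assms(3) by (meson bdd_belowI)
  have I: "Inf A \<in> A" using assms bdd by (intro closed_contains_Inf) auto
  have "(LEAST x. x \<in> A) = Inf A"
    by (rule Least_equality) (use I bdd in \<open>auto intro: cInf_lower\<close>)
  then show "(LEAST x. x \<in> A) \<in> A" "(LEAST x. x \<in> A) \<le> a"
    using I assms(2) bdd by (auto intro: cInf_lower)
qed

context return_chart
begin

abbreviation "F \<equiv> return_map C \<Omega>"

text \<open>\<open>F p\<close> is the point \<open>Y s = p + d p *\<^sub>R w + s *\<^sub>R (\<nu> p - w)\<close> of \<open>C\<close> with the largest admissible \<open>s\<close>. The
  supporting half-space at \<open>c\<close> bounds \<open>s\<close> from above, and the cone of points inside \<open>C\<close> around the inward
  normal at \<open>c\<close> bounds it from below, both by \<open>o (norm (p - c))\<close>.\<close>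

lemma return_map_expansion:
  assumes \<epsilon>: "\<epsilon> > 0"
  shows "\<exists>\<delta>>0. \<forall>p\<in>M. dist p c < \<delta> \<longrightarrow>
    norm (F p - p - (d c / l) *\<^sub>R DG (p - c)) \<le> \<epsilon> * norm (p - c)"
proof -
  interpret DG: bounded_linear DG using dG by (rule has_derivative_bounded_linear)
  obtain K0 where K0: "K0 > 0" "\<And>v. norm (DG v) \<le> norm v * K0" using DG.pos_bounded by blast
  define K where "K = K0 / l"
  have K: "K > 0" using K0 l by (simp add: K_def)
  define B where "B = d c + 1"
  have B: "B > 1" using dpos by (simp add: B_def)
  \<comment> \<open>The final error is \<open>\<eta>\<close> times
    \<open>(K + 1) + B + 8 * (1 + B)\<close>, which is the first denominator; the second bound makes
    \<open>\<epsilon>1\<close> at most 1.\<close>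
  define \<eta> where "\<eta> = min (\<epsilon> / (K + 9 + 9 * B)) (1 / (4 * (1 + B)))"
  \<comment> \<open>A factor 2 compensates for \<open>\<nu> c \<bullet> n\<close> being only at
    least 1/2; the other factor 2 leaves a margin at \<open>s1\<close>, so that \<open>Y s1\<close>
    falls into the cone.\<close>
  define \<epsilon>1 where "\<epsilon>1 = 4 * (1 + B) * \<eta>"
  have \<eta>: "\<eta> > 0" using \<epsilon> K B by (simp add: \<eta>_def)
  have "\<eta> \<le> \<epsilon> / (K + 9 + 9 * B)" "\<eta> \<le> 1 / (4 * (1 + B))" by (simp_all add: \<eta>_def)
  then have \<eta>2: "\<eta> * (K + 9 + 9 * B) \<le> \<epsilon>" and \<epsilon>1: "\<epsilon>1 \<le> 1"
    using K B by (simp_all add: pos_le_divide_eq \<epsilon>1_def mult_ac)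
  have \<epsilon>10: "\<epsilon>1 > 0" using \<eta> B by (simp add: \<epsilon>1_def)
  have "\<eta> * 1 \<le> \<epsilon>1" using \<eta> B by (simp add: \<epsilon>1_def)
  then have \<eta>1: "\<eta> \<le> 1" using \<epsilon>1 by simp
  define R where "R = 3 + B * (K + 1)"
  have R: "R > 0" using B K by (simp add: R_def add_pos_pos)
  \<comment> \<open>The cone aperture: \<open>\<eta>'\<close> times the bound \<open>R * h\<close>
    on \<open>norm (Y s1 - c)\<close> is half of the depth reached at \<open>s1\<close>.\<close>
  define \<eta>' where "\<eta>' = \<eta> * (1 + B) / (2 * R)"
  have \<eta>': "\<eta>' > 0" using \<eta> B R by (simp add: \<eta>'_def)
  obtain \<delta>1 where \<delta>1: "\<delta>1 > 0" "\<And>p. p \<in> M \<Longrightarrow> dist p c < \<delta>1 \<Longrightarrow> \<exists>w. \<nu> p \<bullet> w = 0 \<and>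
    (\<forall>\<theta>. \<nu> p \<bullet> \<theta> = 0 \<longrightarrow> w \<bullet> (\<theta> + d p *\<^sub>R DN p \<theta>) = G p \<bullet> \<theta>) \<and>
    norm (w - DG (p - c) /\<^sub>R l) \<le> \<eta> * norm (p - c)"
    using tilt_expansion[OF \<eta>] by metis
  have "((\<lambda>_. 0::real) has_derivative (\<lambda>v. \<nu> c \<bullet> v)) (at c within M)"
    using hypersurface_normal_outward[OF c] by (simp add: hypersurface_normal_def)
  then obtain \<delta>2 where \<delta>2: "\<delta>2 > 0"
      "\<And>p. p \<in> M \<Longrightarrow> norm (p - c) < \<delta>2 \<Longrightarrow> \<bar>\<nu> c \<bullet> (p - c)\<bar> \<le> \<eta> * norm (p - c)"
    using \<eta> unfolding has_derivative_within_alt by fastforce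
  obtain \<delta>3 where \<delta>3: "\<delta>3 > 0" "\<And>p. p \<in> M \<Longrightarrow> dist p c < \<delta>3 \<Longrightarrow> dist (\<nu> p) (\<nu> c) < 1/4"
    using \<nu>_cont unfolding continuous_within_eps_delta
    by (metis zero_less_divide_1_iff zero_less_numeral)
  \<comment> \<open>The bound by \<open>d c\<close> keeps \<open>d p\<close> positive.\<close>
  define \<eta>d where "\<eta>d = min \<eta> (d c)"
  have "\<eta>d > 0" using \<eta> dpos by (simp add: \<eta>d_def)
  then obtain \<delta>4 where \<delta>4: "\<delta>4 > 0" "\<And>p. p \<in> M \<Longrightarrow> dist p c < \<delta>4 \<Longrightarrow> dist (d p) (d c) < \<eta>d"
    using d_cont unfolding continuous_within_eps_delta by metis
  obtain \<delta>5 where \<delta>5: "\<delta>5 > 0" "\<And>y. y \<noteq> c \<Longrightarrow> dist y c < \<delta>5 \<Longrightarrow>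
      (- \<nu> c) \<bullet> (y - c) > \<eta>' * norm (y - c) \<Longrightarrow> y \<in> C"
    using is_inward_normal_core[OF c] \<eta>' unfolding is_inward_normal_def eventually_at by blast
  obtain \<delta>6 where \<delta>6: "\<delta>6 > 0"
    "\<And>p w. p \<in> M \<Longrightarrow> dist p c < \<delta>6 \<Longrightarrow> \<nu> p \<bullet> w = 0 \<Longrightarrow>
      (\<And>\<theta>. \<nu> p \<bullet> \<theta> = 0 \<Longrightarrow> w \<bullet> (\<theta> + d p *\<^sub>R DN p \<theta>) = G p \<bullet> \<theta>) \<Longrightarrow>
      inward_normal \<Omega> (\<Phi> p) = sgn (w - \<nu> p)"
    using inward_normal_\<Phi> by metis
  define \<delta> where "\<delta> = Min {\<delta>1, \<delta>2, \<delta>3, \<delta>4, \<delta>5 / R, \<delta>6, 1 / (4 * (K + 1))}"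
  have \<delta>: "\<delta> > 0" using \<delta>1(1) \<delta>2(1) \<delta>3(1) \<delta>4(1) \<delta>5(1) \<delta>6(1) R K by (simp add: \<delta>_def)
  have "norm (F p - p - (d c / l) *\<^sub>R DG (p - c)) \<le> \<epsilon> * norm (p - c)"
    if p: "p \<in> M" and "dist p c < \<delta>" for p
  proof -
    have pd: "dist p c < \<delta>1" "dist p c < \<delta>2" "dist p c < \<delta>3" "dist p c < \<delta>4" "dist p c < \<delta>5 / R"
      "dist p c < \<delta>6" "dist p c < 1 / (4 * (K + 1))"
      using \<open>dist p c < \<delta>\<close> by (simp_all add: \<delta>_def)
    define h where "h = norm (p - c)"
    have h0: "h \<ge> 0" by (simp add: h_def)
    obtain w where w: "\<nu> p \<bullet> w = 0"
      "\<And>\<theta>. \<nu> p \<bullet> \<theta> = 0 \<Longrightarrow> w \<bullet> (\<theta> + d p *\<^sub>R DN p \<theta>) = G p \<bullet> \<theta>"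
      "norm (w - DG (p - c) /\<^sub>R l) \<le> \<eta> * h"
      using \<delta>1(2)[OF p pd(1)] unfolding h_def by blast
    define z where "z = DG (p - c) /\<^sub>R l"
    have wz: "norm (w - z) \<le> \<eta> * h" using w(3) by (simp add: z_def)
    have "norm z \<le> K * h" using K0(2)[of "p - c"] l
      by (simp add: z_def K_def h_def field_simps)
    moreover have "\<eta> * h \<le> 1 * h" using \<eta>1 h0 by (intro mult_right_mono) auto
    ultimately have nw: "norm w \<le> (K + 1) * h"
      using norm_triangle_ineq[of "w - z" z] wz by (simp add: algebra_simps)
    have "(K + 1) * h \<le> 1/4" using pd(7) K by (simp add: h_def dist_norm field_simps)
    with nw have nw4: "norm w \<le> 1/4" by linarith
    define n where "n = \<nu> p - w"
    have nn: "norm n \<le> 2" using norm_triangle_ineq4[of "\<nu> p" w] nw4 p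
      by (simp add: n_def norm_outward_normal)
    have \<beta>: "\<nu> c \<bullet> n \<ge> 1/2"
    proof -
      have "\<nu> c \<bullet> n = 1 + \<nu> c \<bullet> (\<nu> p - \<nu> c) - \<nu> c \<bullet> w"
        using c by (simp add: n_def inner_diff_right)
      moreover have "\<bar>\<nu> c \<bullet> (\<nu> p - \<nu> c)\<bar> \<le> 1/4"
        using Cauchy_Schwarz_ineq2[of "\<nu> c" "\<nu> p - \<nu> c"] \<delta>3(2)[OF p pd(3)] c
        by (simp add: norm_outward_normal dist_norm)
      moreover have "\<bar>\<nu> c \<bullet> w\<bar> \<le> 1/4"
        using Cauchy_Schwarz_ineq2[of "\<nu> c" w] nw4 c by (simp add: norm_outward_normal)
      ultimately show ?thesis by linarith
    qed
    have n0: "n \<noteq> 0" using \<beta> by auto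
    have dp: "\<bar>d p - d c\<bar> \<le> \<eta>" "d p > 0" "d p \<le> B"
      using \<delta>4(2)[OF p pd(4)] \<eta>1 by (auto simp: \<eta>d_def dist_real_def B_def)
    define Y where "Y s = p + d p *\<^sub>R w + s *\<^sub>R n" for s
    have "\<nu> c \<bullet> z = 0" using \<nu>DG by (simp add: z_def)
    then have "\<bar>\<nu> c \<bullet> w\<bar> \<le> \<eta> * h"
      using Cauchy_Schwarz_ineq2[of "\<nu> c" "w - z"] wz c by (simp add: inner_diff_right norm_outward_normal)
    then have "d p * \<bar>\<nu> c \<bullet> w\<bar> \<le> B * (\<eta> * h)" using dp B by (intro mult_mono) auto
    then have "\<bar>d p * (\<nu> c \<bullet> w)\<bar> \<le> B * (\<eta> * h)" using dp by (simp add: abs_mult)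
    moreover have "\<bar>\<nu> c \<bullet> (p - c)\<bar> \<le> \<eta> * h" using \<delta>2(2)[OF p] pd(2) by (simp add: h_def dist_norm)
    \<comment> \<open>The height of \<open>Y s\<close> over the tangent hyperplane at
      \<open>c\<close> is linear in \<open>s\<close> up to a small error: \<open>p - c\<close> is
      tangent to first order, and \<open>w\<close> is close to \<open>z\<close>, which is tangent at
      \<open>c\<close>.\<close>
    ultimately have base: "\<bar>\<nu> c \<bullet> (Y s - c) - s * (\<nu> c \<bullet> n)\<bar> \<le> (1 + B) * (\<eta> * h)" for s
      unfolding Y_def by (simp add: inner_add_right inner_diff_right algebra_simps)
    have upper: "s \<le> \<epsilon>1 * h" if "Y s \<in> C" for s
    proof (cases "s \<le> 0")
      case True
      then show ?thesis using \<epsilon>10 h0 by (meson mult_nonneg_nonneg less_imp_le order_trans)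
    next
      case False
      have "s * (1/2) \<le> s * (\<nu> c \<bullet> n)" using False \<beta> by (intro mult_left_mono) auto
      also have "\<dots> \<le> (1 + B) * (\<eta> * h)"
        using base[of s] outward_normal_support[OF c that] by linarith
      finally have "s * (1/2) \<le> (1 + B) * (\<eta> * h)" .
      moreover have "0 \<le> (1 + B) * (\<eta> * h)" using \<eta> B h0 by simp
      moreover have "\<epsilon>1 * h = 4 * ((1 + B) * (\<eta> * h))" by (simp add: \<epsilon>1_def)
      ultimately show ?thesis by linarith
    qed
    define s1 where "s1 = - (\<epsilon>1 * h)"
    have lower: "Y s1 \<in> C"
    proof (cases "h = 0")
      case True
      then have "p = c" "w = 0" using nw by (auto simp: h_def)
      then show ?thesis using True c core_props(6) by (auto simp: Y_def s1_def)
    next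
      case False
      then have h: "h > 0" using h0 by simp
      have "\<epsilon>1 * h * (1/2) \<le> \<epsilon>1 * h * (\<nu> c \<bullet> n)" using \<beta> \<epsilon>10 h by (intro mult_left_mono) auto
      moreover have "\<epsilon>1 * h * (1/2) = 2 * ((1 + B) * (\<eta> * h))" by (simp add: \<epsilon>1_def)
      moreover have "s1 * (\<nu> c \<bullet> n) = - (\<epsilon>1 * h * (\<nu> c \<bullet> n))" by (simp add: s1_def)
      ultimately have below: "(1 + B) * (\<eta> * h) \<le> (- \<nu> c) \<bullet> (Y s1 - c)"
        using base[of s1] unfolding inner_minus_left by linarith
      have "norm (Y s1 - c) \<le> norm (p - c) + norm (d p *\<^sub>R w) + norm (s1 *\<^sub>R n)"
        using norm_triangle_ineq[of "p - c + d p *\<^sub>R w" "s1 *\<^sub>R n"] norm_triangle_ineq[of "p - c" "d p *\<^sub>R w"]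
        by (simp add: Y_def algebra_simps)
      also have "\<dots> \<le> h + B * ((K + 1) * h) + h * 2"
      proof (intro add_mono)
        show "norm (p - c) \<le> h" by (simp add: h_def)
        show "norm (d p *\<^sub>R w) \<le> B * ((K + 1) * h)" using dp nw B by (auto intro!: mult_mono)
        have "\<epsilon>1 * h \<le> 1 * h" using \<epsilon>1 h0 by (intro mult_right_mono) auto
        then show "norm (s1 *\<^sub>R n) \<le> h * 2" using nn \<epsilon>10 h0 by (auto simp: s1_def abs_mult intro!: mult_mono)
      qed
      also have "\<dots> = R * h" by (simp add: R_def algebra_simps)
      finally have Yn: "norm (Y s1 - c) \<le> R * h" .
      have "\<eta>' * norm (Y s1 - c) \<le> \<eta>' * (R * h)" using Yn \<eta>' by (intro mult_left_mono) auto
      also have "\<dots> = (1 + B) * (\<eta> * h) / 2" using R by (simp add: \<eta>'_def)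
      also have "\<dots> < (1 + B) * (\<eta> * h)" using B \<eta> h by simp
      also note below
      finally have "\<eta>' * norm (Y s1 - c) < (- \<nu> c) \<bullet> (Y s1 - c)" .
      moreover have "dist (Y s1) c < \<delta>5"
        using Yn pd(5) R by (simp add: h_def dist_norm field_simps)
      moreover from calculation(1) have "Y s1 \<noteq> c" by auto
      ultimately show ?thesis using \<delta>5(2) by blast
    qed
    define A where "A = {t. t \<ge> 0 \<and> \<Phi> p + t *\<^sub>R sgn (- n) \<in> C}"
    \<comment> \<open>Travelling a length \<open>t\<close> along the inward normal lowers the
      parameter of \<open>Y\<close> from \<open>d p\<close> by \<open>t / norm n\<close>; the least
      \<open>t\<close> thus gives the largest \<open>s\<close> not above \<open>d p\<close>.\<close>
    have Yt: "\<Phi> p + t *\<^sub>R sgn (- n) = Y (d p - t / norm n)" for t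
    proof -
      have "\<Phi> p = p + d p *\<^sub>R w + d p *\<^sub>R n" by (simp add: radial_map_def n_def algebra_simps)
      moreover have "sgn (- n) = - (inverse (norm n) *\<^sub>R n)" by (simp add: sgn_div_norm)
      ultimately show ?thesis by (simp add: Y_def algebra_simps divide_inverse)
    qed
    have cl: "closed A"
    proof -
      have "A = {0..} \<inter> (\<lambda>t. \<Phi> p + t *\<^sub>R sgn (- n)) -` C" by (auto simp: A_def)
      then show ?thesis
        by (simp only:) (intro closed_Int closed_vimage core_props closed_atLeast continuous_intros)
    qed
    have s1A: "norm n * (d p - s1) \<in> A"
      unfolding A_def Yt using lower n0 dp \<epsilon>10 h0 by (simp add: s1_def)
    define t where "t = (LEAST t. t \<in> A)"
    have t: "t \<in> A" "t \<le> norm n * (d p - s1)"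
      using Least_real_closed[OF cl s1A, of 0] by (auto simp: t_def A_def)
    define s where "s = d p - t / norm n"
    have Fp: "F p = Y s"
      using \<delta>6(2)[OF p pd(6) w(1,2)]
      unfolding return_map_def reciprocal_map_def o_def s_def Yt[symmetric] t_def A_def
      by (simp add: n_def)
    have "s \<le> \<epsilon>1 * h" using t(1) by (intro upper) (simp add: A_def Yt s_def)
    moreover have "t / norm n \<le> d p - s1" using t(2) n0 by (simp add: divide_le_eq mult.commute)
    then have "- (\<epsilon>1 * h) \<le> s" by (simp add: s_def s1_def)
    ultimately have s: "\<bar>s\<bar> \<le> \<epsilon>1 * h" by (simp add: abs_le_iff)
    have "F p - p - (d c / l) *\<^sub>R DG (p - c) = (d p - d c) *\<^sub>R w + d c *\<^sub>R (w - z) + s *\<^sub>R n"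
      unfolding Fp Y_def z_def by (simp add: algebra_simps divide_inverse)
    also have "norm \<dots> \<le> norm ((d p - d c) *\<^sub>R w) + norm (d c *\<^sub>R (w - z)) + norm (s *\<^sub>R n)"
      by (meson norm_triangle_mono norm_triangle_ineq order_refl)
    also have "\<dots> \<le> \<eta> * ((K + 1) * h) + B * (\<eta> * h) + \<epsilon>1 * h * 2"
    proof (intro add_mono)
      show "norm ((d p - d c) *\<^sub>R w) \<le> \<eta> * ((K + 1) * h)" using dp nw \<eta> by (auto intro!: mult_mono)
      show "norm (d c *\<^sub>R (w - z)) \<le> B * (\<eta> * h)" using dpos wz by (auto simp: B_def intro!: mult_mono)
      show "norm (s *\<^sub>R n) \<le> \<epsilon>1 * h * 2" using s nn \<epsilon>10 h0 by (auto intro!: mult_mono)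
    qed
    also have "\<dots> = (\<eta> * (K + 9 + 9 * B)) * h" by (simp add: \<epsilon>1_def algebra_simps)
    also have "\<dots> \<le> \<epsilon> * h" using \<eta>2 h0 by (intro mult_right_mono) auto
    finally show ?thesis by (simp add: h_def)
  qed
  with \<delta> show ?thesis by blast
qed

text \<open>At \<open>p = c\<close> the right-hand side of the expansion is zero.\<close>

lemma return_map_fixed: "F c = c"
  using return_map_expansion[of 1] c dG has_derivative_linear[of G DG] by (auto simp: linear_0)

lemma return_map_derivative: "(F has_derivative (\<lambda>v. v + (d c / l) *\<^sub>R DG v)) (at c within M)"
proof -
  have "bounded_linear (\<lambda>v. v + (d c / l) *\<^sub>R DG v)"
    by (intro bounded_linear_intros bounded_linear_const_scaleR has_derivative_bounded_linear[OF dG])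
  moreover have "\<exists>\<delta>>0. \<forall>p\<in>M. norm (p - c) < \<delta> \<longrightarrow>
      norm (F p - F c - (p - c + (d c / l) *\<^sub>R DG (p - c))) \<le> e * norm (p - c)" if "e > 0" for e
    using return_map_expansion[OF that] unfolding return_map_fixed dist_norm
    by (simp add: algebra_simps)
  ultimately show ?thesis unfolding has_derivative_within_alt by blast
qed

end

section \<open>Recovering the Hessian\<close>

context smooth_core
begin

lemma thickness_hessian_tangent:
  assumes iso: "isotropic_return C \<Omega> c \<alpha>"
  shows "v \<in> T c \<Longrightarrow> thickness_hessian C \<Omega> c v \<in> T c" "thickness_hessian C \<Omega> c 0 = 0"
proof -
  have c: "c \<in> M" and C2: "C2_on_hypersurface M (thickness C \<Omega>)"
    and crit: "riemannian_gradient C (thickness C \<Omega>) c = 0"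
    using iso by (auto simp: isotropic_return_def nondegenerate_critical_point_def)
  obtain r G DG where *: "(G has_derivative DG) (at c)" "\<And>v. \<nu> c \<bullet> DG v = 0"
    "\<And>v. v \<in> T c \<Longrightarrow> thickness_hessian C \<Omega> c v = DG v"
    using gradient_extension[OF c C2 crit] by metis
  show "thickness_hessian C \<Omega> c v \<in> T c" if "v \<in> T c"
    using * that by (simp add: tangent_space_def)
  have "0 \<in> T c" by (simp add: tangent_space_def)
  then show "thickness_hessian C \<Omega> c 0 = 0"
    using * has_derivative_linear linear_0 by metis
qed

text \<open>The factor is \<open>d c / l\<close> with \<open>l = 2 d(c) / \<alpha>\<close>. A
  nonzero tangent vector is required because on a trivial tangent space isotropy is vacuous and does
  not give \<open>d c > 0\<close>.\<close>

lemma return_differential_isotropic: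
  assumes iso: "isotropic_return C \<Omega> c \<alpha>" and v: "v \<in> T c" "v \<noteq> 0"
  shows "return_differential C \<Omega> c v = v + (\<alpha> / 2) *\<^sub>R thickness_hessian C \<Omega> c v"
proof -
  define d where "d = thickness C \<Omega>"
  have c: "c \<in> M" and C2: "C2_on_hypersurface M d" and \<alpha>: "\<alpha> > 0"
    and crit: "riemannian_gradient C d c = 0"
    and adm: "\<Omega> \<in> admissible_sets C" "finite_thickness C \<Omega>"
    using iso by (auto simp: isotropic_return_def nondegenerate_critical_point_def d_def)
  obtain r1 N DN where r1: "r1 > 0"
    and N1: "\<And>y. y \<in> ball c r1 \<Longrightarrow> norm (N y) = 1"
    and dN: "\<And>y. y \<in> ball c r1 \<Longrightarrow> (N has_derivative DN y) (at y)"
    and DNc: "\<And>v. continuous_on (ball c r1) (\<lambda>y. DN y v)"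
    and N\<nu>: "\<And>q. q \<in> M \<Longrightarrow> q \<in> ball c r1 \<Longrightarrow> N q = \<nu> q"
    using smooth_normal_extension[OF c] by metis
  obtain r2 G DG where r2: "r2 > 0"
    and dd: "\<And>q. q \<in> M \<Longrightarrow> q \<in> ball c r2 \<Longrightarrow> (d has_derivative (\<lambda>v. G q \<bullet> v)) (at q within M)"
    and \<nu>G: "\<And>q. q \<in> M \<Longrightarrow> q \<in> ball c r2 \<Longrightarrow> \<nu> q \<bullet> G q = 0"
    and G: "G c = 0" "(G has_derivative DG) (at c)" "\<And>v. \<nu> c \<bullet> DG v = 0"
    and H: "\<And>v. v \<in> T c \<Longrightarrow> riemannian_hessian C d c v = DG v"
    using gradient_extension[OF c C2 crit] by metis
  define r where "r = min r1 r2"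
  have r: "r > 0" "ball c r \<subseteq> ball c r1" "ball c r \<subseteq> ball c r2" using r1 r2 by (auto simp: r_def)
  have d\<nu>: "(\<nu> has_derivative DN q) (at q within M)" if q: "q \<in> M" "q \<in> ball c r" for q
  proof -
    obtain \<rho> where \<rho>: "\<rho> > 0" "ball q \<rho> \<subseteq> ball c r" using q openE[OF open_ball] by metis
    have "q \<in> ball c r1" using q r by blast
    from has_derivative_at_withinI[OF dN[OF this]] show ?thesis
      by (rule has_derivative_transform_within[OF _ \<rho>(1) q(1)])
         (use N\<nu> \<rho> r in \<open>auto simp: dist_commute subset_iff\<close>)
  qed
  have \<nu>DN: "\<nu> q \<bullet> DN q v = 0" if q: "q \<in> M" "q \<in> ball c r" for q v
  proof -
    have q1: "q \<in> ball c r1" using q r by blast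
    obtain \<rho> where \<rho>: "\<rho> > 0" "ball q \<rho> \<subseteq> ball c r1" using q1 openE[OF open_ball] by metis
    have "((\<lambda>y. N y \<bullet> N y) has_derivative (\<lambda>v. N q \<bullet> DN q v + DN q v \<bullet> N q)) (at q)"
      using dN[OF q1] by (intro has_derivative_inner)
    then have "((\<lambda>y. 1) has_derivative (\<lambda>v. N q \<bullet> DN q v + DN q v \<bullet> N q)) (at q)"
      by (rule has_derivative_transform_within[OF _ \<rho>(1)])
         (use N1 \<rho> in \<open>auto simp: dist_commute subset_iff norm_eq_1\<close>)
    from has_derivative_unique[OF this has_derivative_const]
    show ?thesis using N\<nu>[OF q(1) q1] by (simp add: fun_eq_iff inner_commute)
  qed
  have cr: "c \<in> ball c r" using r by simp
  have DN_cont: "((\<lambda>q. DN q v) \<longlongrightarrow> DN c v) (at c within M)" for v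
  proof -
    have "isCont (\<lambda>q. DN q v) c"
      using DNc[of v] r1 by (simp add: continuous_on_eq_continuous_at)
    then show ?thesis by (simp add: isCont_def Lim_at_imp_Lim_at_within)
  qed
  note shape = isotropic_shape[OF iso v d\<nu>[OF c cr], folded d_def]
  have "return_chart C \<Omega> c (2 * d c / \<alpha>) r DN G DG"
  proof (unfold_locales, goal_cases)
    case 1 show ?case by (rule c)
  next
    case 2 show ?case by (rule adm)
  next
    case 3 show ?case by (rule adm)
  next
    case 4 show ?case using shape(1) by (simp add: d_def)
  next
    case 5 show ?case by (rule r)
  next
    case 6 show ?case using shape(1) \<alpha> by simp
  next
    case (7 q) then show ?case by (rule d\<nu>)
  next
    case (8 q v) then show ?case by (rule \<nu>DN)
  next
    case (9 v) show ?case by (rule DN_cont)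
  next
    case (10 q) then show ?case using dd r unfolding d_def by blast
  next
    case (11 q) then show ?case using \<nu>G r by blast
  next
    case 12 show ?case by (rule G)
  next
    case 13 show ?case by (rule has_derivative_at_withinI[OF G(2)])
  next
    case (14 v) show ?case by (rule G)
  next
    case (15 v) then show ?case using shape(2)[of v] by (simp add: d_def tangent_space_def)
  qed
  then interpret return_chart C \<Omega> c "2 * d c / \<alpha>" r DN G DG .
  have "return_differential C \<Omega> c v = v + (thickness C \<Omega> c / (2 * d c / \<alpha>)) *\<^sub>R DG v"
    unfolding return_differential_def by (rule boundary_differential_eq[OF c return_map_derivative v(1)])
  also have "thickness C \<Omega> c / (2 * d c / \<alpha>) = \<alpha> / 2" using shape(1) by (simp add: d_def)
  finally show ?thesis using H[OF v(1)] by (simp add: d_def)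
qed

text \<open>Isotropy describes the geometric operator on tangent vectors only, hence the appeal to
  tangency of the Hessian's values.\<close>

lemma return_linearization_isotropic:
  assumes iso: "isotropic_return C \<Omega> c \<alpha>" and v: "v \<in> T c"
  shows "return_linearization C \<Omega> c v = v - \<alpha> *\<^sub>R thickness_hessian C \<Omega> c v"
  using iso thickness_hessian_tangent(1)[OF iso v]
  by (simp add: return_linearization_def isotropic_return_def)

end

section \<open>Spectral data of affinely related operators, and the comparison of two
  configurations\<close>

lemma eigendirections_affine:
  assumes "\<kappa> \<noteq> 0" "\<And>v. v \<in> T \<Longrightarrow> v \<noteq> 0 \<Longrightarrow> D v = v + \<kappa> *\<^sub>R L v"
  shows "eigendirections T D = eigendirections T L"
proof -
  have "(\<exists>\<mu>. D v = \<mu> *\<^sub>R v) \<longleftrightarrow> (\<exists>\<mu>. L v = \<mu> *\<^sub>R v)" if v: "v \<in> T" "v \<noteq> 0" for v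
  proof
    assume "\<exists>\<mu>. D v = \<mu> *\<^sub>R v"
    then obtain \<mu> where "v + \<kappa> *\<^sub>R L v = \<mu> *\<^sub>R v" using assms(2)[OF v] by auto
    then have "\<kappa> *\<^sub>R L v = (\<mu> - 1) *\<^sub>R v" by (simp add: algebra_simps)
    then have "(1 / \<kappa>) *\<^sub>R (\<kappa> *\<^sub>R L v) = ((\<mu> - 1) / \<kappa>) *\<^sub>R v" by simp
    then show "\<exists>\<mu>. L v = \<mu> *\<^sub>R v" using assms(1) by auto
  next
    assume "\<exists>\<mu>. L v = \<mu> *\<^sub>R v"
    then obtain \<mu> where "L v = \<mu> *\<^sub>R v" by blast
    then have "D v = (1 + \<kappa> * \<mu>) *\<^sub>R v" using assms(2)[OF v] by (simp add: algebra_simps)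
    then show "\<exists>\<mu>. D v = \<mu> *\<^sub>R v" by blast
  qed
  then show ?thesis unfolding eigendirections_def by (intro Collect_cong) metis
qed

text \<open>One inclusion is enough, as the hypotheses are symmetric under exchanging the two
  operators with their factors.\<close>

lemma eigenvalues_scale:
  assumes "(a::real) > 0" "b > 0" "\<And>v. v \<in> T \<Longrightarrow> a *\<^sub>R L v = b *\<^sub>R L' v"
  shows "(\<lambda>\<mu>. a * \<mu>) ` eigenvalues T L \<subseteq> (\<lambda>\<mu>. b * \<mu>) ` eigenvalues T L'"
proof safe
  fix \<mu> assume "\<mu> \<in> eigenvalues T L"
  then obtain v where v: "v \<in> T" "v \<noteq> 0" "L v = \<mu> *\<^sub>R v" by (auto simp: eigenvalues_def)
  have "b *\<^sub>R L' v = (a * \<mu>) *\<^sub>R v" using assms(3)[OF v(1)] v(3) by simp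
  then have "(1 / b) *\<^sub>R (b *\<^sub>R L' v) = (a * \<mu> / b) *\<^sub>R v" by simp
  then have "L' v = (a * \<mu> / b) *\<^sub>R v" using assms(2) by simp
  then have "a * \<mu> / b \<in> eigenvalues T L'" using v by (auto simp: eigenvalues_def)
  then show "a * \<mu> \<in> (\<lambda>\<mu>. b * \<mu>) ` eigenvalues T L'"
    using assms(2) by (intro image_eqI[of _ _ "a * \<mu> / b"]) auto
qed

text \<open>Being determined by \<open>DF\<close> is rendered as a comparison with an arbitrary
  second isotropic configuration that has the same tangent space and the same \<open>DF\<close> on
  it. The last clause expresses the dependence of the absolute curvature scale on
  \<open>\<alpha>\<close>.\<close>

theorem theorem8p3:
  fixes C \<Omega> :: "'a::euclidean_space set" and c :: 'a and \<alpha> :: real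
    and DF :: "'a set \<Rightarrow> 'a set \<Rightarrow> 'a \<Rightarrow> 'a \<Rightarrow> 'a"
  assumes DF: "DF = return_differential \<or> DF = return_linearization"
    and iso: "isotropic_return C \<Omega> c \<alpha>"
  shows "eigendirections (tangent_space C c) (thickness_hessian C \<Omega> c)
           = eigendirections (tangent_space C c) (DF C \<Omega> c)
    \<and> (\<forall>C' \<Omega>' c' \<alpha>'.
         isotropic_return C' \<Omega>' c' \<alpha>' \<and> tangent_space C' c' = tangent_space C c
         \<and> (\<forall>v\<in>tangent_space C c. DF C' \<Omega>' c' v = DF C \<Omega> c v)
       \<longrightarrow> eigendirections (tangent_space C' c') (thickness_hessian C' \<Omega>' c')
             = eigendirections (tangent_space C c) (thickness_hessian C \<Omega> c)
         \<and> (\<lambda>\<mu>. \<alpha>' * \<mu>) ` eigenvalues (tangent_space C' c') (thickness_hessian C' \<Omega>' c')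
             = (\<lambda>\<mu>. \<alpha> * \<mu>) ` eigenvalues (tangent_space C c) (thickness_hessian C \<Omega> c)
         \<and> (\<forall>v\<in>tangent_space C c. \<alpha>' *\<^sub>R thickness_hessian C' \<Omega>' c' v
                                  = \<alpha> *\<^sub>R thickness_hessian C \<Omega> c v)
         \<and> (\<forall>v\<in>tangent_space C c. v \<noteq> 0 \<longrightarrow>
              (thickness_hessian C' \<Omega>' c' v = thickness_hessian C \<Omega> c v \<longleftrightarrow> \<alpha>' = \<alpha>)))"
proof -
  \<comment> \<open>\<open>k\<close> is fixed before any configuration is, so one value serves both
    sides of the comparison.\<close>
  obtain k :: real where k: "k \<noteq> 0"
    and DFk: "\<And>C \<Omega> c \<alpha> v. isotropic_return C \<Omega> c \<alpha> \<Longrightarrow> v \<in> tangent_space C c \<Longrightarrow> v \<noteq> 0 \<Longrightarrow>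
        DF C \<Omega> c v = v + (k * \<alpha>) *\<^sub>R thickness_hessian C \<Omega> c v"
  proof (rule disjE[OF DF])
    assume D: "DF = return_differential"
    show thesis
      by (rule that[of "1/2"])
         (auto simp: D isotropic_return_def smooth_core_def intro!: smooth_core.return_differential_isotropic[THEN trans])
  next
    assume D: "DF = return_linearization"
    show thesis
      by (rule that[of "-1"])
         (auto simp: D isotropic_return_def smooth_core_def intro!: smooth_core.return_linearization_isotropic[THEN trans])
  qed
  have core: "smooth_core C" if "isotropic_return C \<Omega> c \<alpha>" for C :: "'a set" and \<Omega> c \<alpha>
    using that by (simp add: isotropic_return_def smooth_core_def)
  have \<alpha>: "\<alpha> > 0" and inj: "inj_on (thickness_hessian C \<Omega> c) (tangent_space C c)"
    using iso by (auto simp: isotropic_return_def nondegenerate_critical_point_def bij_betw_def)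
  have dirs: "eigendirections (tangent_space C c) (DF C \<Omega> c)
      = eigendirections (tangent_space C c) (thickness_hessian C \<Omega> c)"
    if "isotropic_return C \<Omega> c \<alpha>" for C \<Omega> :: "'a set" and c \<alpha>
    by (rule eigendirections_affine[of "k * \<alpha>"]) (use k DFk[OF that] that in \<open>auto simp: isotropic_return_def\<close>)
  show ?thesis
  proof (intro conjI allI impI; (elim conjE)?)
    show "eigendirections (tangent_space C c) (thickness_hessian C \<Omega> c)
           = eigendirections (tangent_space C c) (DF C \<Omega> c)" using dirs[OF iso] by simp
    fix C' \<Omega>' c' \<alpha>'
    assume iso': "isotropic_return C' \<Omega>' c' \<alpha>'" and T: "tangent_space C' c' = tangent_space C c"
      and eq: "\<forall>v\<in>tangent_space C c. DF C' \<Omega>' c' v = DF C \<Omega> c v"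
    have \<alpha>': "\<alpha>' > 0" using iso' by (simp add: isotropic_return_def)
    have scaled: "\<alpha>' *\<^sub>R thickness_hessian C' \<Omega>' c' v = \<alpha> *\<^sub>R thickness_hessian C \<Omega> c v"
      if v: "v \<in> tangent_space C c" for v
    proof (cases "v = 0")
      case True
      then show ?thesis
        using smooth_core.thickness_hessian_tangent(2)[OF core iso, OF iso]
          smooth_core.thickness_hessian_tangent(2)[OF core iso', OF iso'] by simp
    next
      case False
      have "v + (k * \<alpha>') *\<^sub>R thickness_hessian C' \<Omega>' c' v = v + (k * \<alpha>) *\<^sub>R thickness_hessian C \<Omega> c v"
        using DFk[OF iso v False] DFk[OF iso', of v] T v False eq by simp
      then have "k *\<^sub>R (\<alpha>' *\<^sub>R thickness_hessian C' \<Omega>' c' v) = k *\<^sub>R (\<alpha> *\<^sub>R thickness_hessian C \<Omega> c v)"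
        by simp
      then show ?thesis using k by (simp only: scaleR_cancel_left) simp
    qed
    show "eigendirections (tangent_space C' c') (thickness_hessian C' \<Omega>' c')
             = eigendirections (tangent_space C c) (thickness_hessian C \<Omega> c)"
    proof -
      have "eigendirections (tangent_space C c) (DF C' \<Omega>' c') = eigendirections (tangent_space C c) (DF C \<Omega> c)"
        unfolding eigendirections_def using eq by (intro Collect_cong) metis
      then show ?thesis using dirs[OF iso] dirs[OF iso'] T by simp
    qed
    show "(\<lambda>\<mu>. \<alpha>' * \<mu>) ` eigenvalues (tangent_space C' c') (thickness_hessian C' \<Omega>' c')
             = (\<lambda>\<mu>. \<alpha> * \<mu>) ` eigenvalues (tangent_space C c) (thickness_hessian C \<Omega> c)"
      unfolding T using scaled \<alpha> \<alpha>' by (intro equalityI eigenvalues_scale) auto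
    show "\<forall>v\<in>tangent_space C c. \<alpha>' *\<^sub>R thickness_hessian C' \<Omega>' c' v
        = \<alpha> *\<^sub>R thickness_hessian C \<Omega> c v" using scaled by blast
    show "\<forall>v\<in>tangent_space C c. v \<noteq> 0 \<longrightarrow>
        (thickness_hessian C' \<Omega>' c' v = thickness_hessian C \<Omega> c v \<longleftrightarrow> \<alpha>' = \<alpha>)"
    proof (intro ballI impI)
      fix v assume v: "v \<in> tangent_space C c" "v \<noteq> 0"
      \<comment> \<open>Nondegeneracy enters here: the scaled Hessians agree at \<open>v\<close>,
        and as the value is nonzero, equality without the factors forces the factors to be
        equal.\<close>
      have "thickness_hessian C \<Omega> c v \<noteq> 0"
        using inj_onD[OF inj, of v 0] v smooth_core.thickness_hessian_tangent(2)[OF core iso, OF iso]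
        by (auto simp: tangent_space_def)
      then show "thickness_hessian C' \<Omega>' c' v = thickness_hessian C \<Omega> c v \<longleftrightarrow> \<alpha>' = \<alpha>"
        using scaled[OF v(1)] \<alpha> \<alpha>' by auto
    qed
  qed
qed

end
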